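(* Suppose that $X$ is a uniformly locally finite metric space admitting a sequence $(\Pi_n)_{n=1}^\infty$ of partitions of $X$ such that for every $n\geq1$, we have (i) $\Pi_n$ is a refinement of $\Pi_{n+1}$; (ii) $|P|=2^n$ for every $P\in\Pi_n$; (iii) $\sup\{\operatorname{diam}(P):P\in\Pi_n\}<\infty$. Then the uniform Roe algebra $C_u^*(X)$ contains an embedded copy of the CAR-algebra.
   Context: A metric space $X$ is uniformly locally finite if $\sup_{x\in X}|B_X(x,r)|<\infty$ for every $r>0$, where $B_X(x,r)$ is the open ball of radius $r$ around $x$ and $|\cdot|$ denotes cardinality. The propagation of a linear operator $a$ on $\ell^2(X)$ is $\sup\{d(x,y):\langle a\delta_y,\delta_x\rangle\neq0\}$, where $(\delta_x)_{x\in X}$ is the standard basis. The uniform Roe algebra $C_u^*(X)$ is the norm closure, in the bounded operators on $\ell^2(X)$, of the algebra of operators with finite propagation and uniformly bounded matrix coefficients. The CAR-algebra is the UHF-algebra of type $2^\infty$, i.e., the direct limit of the matrix algebras $M_{2^n}(\mathbb{C})$ under unital embeddings $M_{2^n}(\mathbb{C})\to M_{2^{n+1}}(\mathbb{C})$. *)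

theory Defs
  imports
    "HOL-Analysis.Analysis"
    "HOL-Library.Disjoint_Sets"
    "HOL-Algebra.Module"
    "Jordan_Normal_Form.Schur_Decomposition"
begin

section \<open>The complex Hilbert space $\ell^2(X)$\<close>

definition square_summable :: "('a \<Rightarrow> complex) \<Rightarrow> bool" where
  "square_summable f \<longleftrightarrow> (\<lambda>x. (cmod (f x))\<^sup>2) summable_on UNIV"

lemma square_summable_mult:
  assumes "square_summable f" "square_summable g"
  shows "(\<lambda>x. norm (f x * cnj (g x))) summable_on UNIV"
proof (rule Infinite_Sum.abs_summable_on_comparison_test')
  show "(\<lambda>x. (cmod (f x))\<^sup>2 + (cmod (g x))\<^sup>2) summable_on UNIV"
    using assms unfolding square_summable_def by (rule summable_on_add)
  show "norm (f x * cnj (g x)) \<le> (cmod (f x))\<^sup>2 + (cmod (g x))\<^sup>2" for x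
  proof -
    have "2 * (cmod (f x) * cmod (g x)) \<le> (cmod (f x))\<^sup>2 + (cmod (g x))\<^sup>2"
      using sum_squares_bound[of "cmod (f x)" "cmod (g x)"] by (simp add: mult.assoc)
    moreover have "0 \<le> cmod (f x) * cmod (g x)" by simp
    ultimately have "cmod (f x) * cmod (g x) \<le> (cmod (f x))\<^sup>2 + (cmod (g x))\<^sup>2"
      by linarith
    then show ?thesis by (simp add: norm_mult)
  qed
qed

lemma square_summable_0: "square_summable (\<lambda>_. 0)"
  by (simp add: square_summable_def)

lemma square_summable_scale: "square_summable f \<Longrightarrow> square_summable (\<lambda>x. c * f x)"
  unfolding square_summable_def norm_mult power_mult_distrib by (rule summable_on_cmult_right)

lemma square_summable_add:
  assumes "square_summable f" "square_summable g"
  shows "square_summable (\<lambda>x. f x + g x)"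
proof -
  have "(\<lambda>x. norm ((cmod (f x + g x))\<^sup>2)) summable_on UNIV"
  proof (rule Infinite_Sum.abs_summable_on_comparison_test')
    show "(\<lambda>x. 2 * (cmod (f x))\<^sup>2 + 2 * (cmod (g x))\<^sup>2) summable_on UNIV"
      using assms unfolding square_summable_def
      by (intro summable_on_add summable_on_cmult_right)
    fix x
    have "(cmod (f x + g x))\<^sup>2 \<le> (cmod (f x) + cmod (g x))\<^sup>2"
      by (intro power_mono norm_triangle_ineq) simp
    also have "\<dots> \<le> 2 * (cmod (f x))\<^sup>2 + 2 * (cmod (g x))\<^sup>2"
      using sum_squares_bound[of "cmod (f x)" "cmod (g x)"] by (simp add: power2_sum)
    finally show "norm ((cmod (f x + g x))\<^sup>2) \<le> 2 * (cmod (f x))\<^sup>2 + 2 * (cmod (g x))\<^sup>2"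
      by simp
  qed
  then show ?thesis by (simp add: square_summable_def)
qed

typedef 'a ell2 = "{f :: 'a \<Rightarrow> complex. square_summable f}"
  morphisms ell2_coeff Abs_ell2
  using square_summable_0 by blast

setup_lifting type_definition_ell2

lemma square_summable_coeff: "square_summable (ell2_coeff f)"
  using ell2_coeff[of f] by simp

lift_definition scaleC_ell2 :: "complex \<Rightarrow> 'a ell2 \<Rightarrow> 'a ell2" is "\<lambda>c f x. c * f x"
  by (rule square_summable_scale)

lift_definition delta_ell2 :: "'a \<Rightarrow> 'a ell2" is "\<lambda>y x. if x = y then 1 else 0"
proof -
  fix y :: 'a
  have "(\<lambda>x. (cmod (if x = y then 1 else 0))\<^sup>2) summable_on {y}"
    by (rule summable_on_finite) simp
  then show "square_summable (\<lambda>x. if x = y then 1 else 0)"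
    unfolding square_summable_def
    by (rule summable_on_cong_neutral[THEN iffD1, rotated -1]) auto
qed

definition cinner_ell2 :: "'a ell2 \<Rightarrow> 'a ell2 \<Rightarrow> complex" where
  "cinner_ell2 f g = (\<Sum>\<^sub>\<infinity>x. ell2_coeff f x * cnj (ell2_coeff g x))"

instantiation ell2 :: (type) real_vector
begin

lift_definition zero_ell2 :: "'a ell2" is "\<lambda>_. 0" by (rule square_summable_0)

lift_definition plus_ell2 :: "'a ell2 \<Rightarrow> 'a ell2 \<Rightarrow> 'a ell2" is "\<lambda>f g x. f x + g x"
  by (rule square_summable_add)

lift_definition uminus_ell2 :: "'a ell2 \<Rightarrow> 'a ell2" is "\<lambda>f x. - f x"
  by (simp add: square_summable_def)

lift_definition minus_ell2 :: "'a ell2 \<Rightarrow> 'a ell2 \<Rightarrow> 'a ell2" is "\<lambda>f g x. f x - g x"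
proof -
  fix f g :: "'a \<Rightarrow> complex"
  assume "square_summable f" "square_summable g"
  then show "square_summable (\<lambda>x. f x - g x)"
    using square_summable_add[of f "\<lambda>x. - 1 * g x"] square_summable_scale[of g "- 1"] by simp
qed

lift_definition scaleR_ell2 :: "real \<Rightarrow> 'a ell2 \<Rightarrow> 'a ell2" is "\<lambda>r f x. complex_of_real r * f x"
  by (rule square_summable_scale)

instance
  by standard (transfer; auto simp: algebra_simps)+

end

lemma cinner_ell2_summable:
  "(\<lambda>x. ell2_coeff f x * cnj (ell2_coeff g x)) summable_on UNIV"
  by (rule abs_summable_summable, rule square_summable_mult) (rule square_summable_coeff)+

lemma cinner_ell2_add_left: "cinner_ell2 (f + g) h = cinner_ell2 f h + cinner_ell2 g h"
  unfolding cinner_ell2_def plus_ell2.rep_eq distrib_right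
  by (intro infsum_add cinner_ell2_summable)

lemma cinner_ell2_scaleR_left: "cinner_ell2 (r *\<^sub>R f) g = complex_of_real r * cinner_ell2 f g"
  unfolding cinner_ell2_def scaleR_ell2.rep_eq mult.assoc
  by (rule infsum_cmult_right) (rule cinner_ell2_summable)

lemma cinner_ell2_commute: "cinner_ell2 f g = cnj (cinner_ell2 g f)"
  unfolding cinner_ell2_def infsum_cnj[symmetric] by (simp add: mult.commute)

lemma cinner_ell2_self:
  "cinner_ell2 f f = complex_of_real (\<Sum>\<^sub>\<infinity>x. (cmod (ell2_coeff f x))\<^sup>2)"
  unfolding cinner_ell2_def complex_norm_square[symmetric]
  by (intro infsumI has_sum_of_real has_sum_infsum)
    (use square_summable_coeff square_summable_def in blast)

instantiation ell2 :: (type) real_inner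
begin

definition inner_ell2 :: "'a ell2 \<Rightarrow> 'a ell2 \<Rightarrow> real" where
  "inner_ell2 f g = Re (cinner_ell2 f g)"

definition norm_ell2 :: "'a ell2 \<Rightarrow> real" where
  "norm_ell2 f = sqrt (\<Sum>\<^sub>\<infinity>x. (cmod (ell2_coeff f x))\<^sup>2)"

definition sgn_ell2 :: "'a ell2 \<Rightarrow> 'a ell2" where
  "sgn_ell2 f = f /\<^sub>R norm f"

definition dist_ell2 :: "'a ell2 \<Rightarrow> 'a ell2 \<Rightarrow> real" where
  "dist_ell2 f g = norm (f - g)"

definition uniformity_ell2 :: "('a ell2 \<times> 'a ell2) filter" where
  "uniformity_ell2 = (INF e\<in>{0<..}. principal {(x, y). dist x y < e})"

definition open_ell2 :: "'a ell2 set \<Rightarrow> bool" where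
  "open_ell2 U \<longleftrightarrow> (\<forall>x\<in>U. eventually (\<lambda>(x', y). x' = x \<longrightarrow> y \<in> U) uniformity)"

instance
proof
  fix f g h :: "'a ell2" and r :: real
  show "dist f g = norm (f - g)" by (rule dist_ell2_def)
  show "sgn f = f /\<^sub>R norm f" by (rule sgn_ell2_def)
  show "(uniformity :: ('a ell2 \<times> 'a ell2) filter)
      = (INF e\<in>{0<..}. principal {(x, y). dist x y < e})"
    by (rule uniformity_ell2_def)
  show "open U \<longleftrightarrow> (\<forall>x\<in>U. eventually (\<lambda>(x', y). x' = x \<longrightarrow> y \<in> U) uniformity)"
    for U :: "'a ell2 set"
    by (rule open_ell2_def)
  show "inner f g = inner g f"
    unfolding inner_ell2_def by (subst cinner_ell2_commute) simp
  show "inner (f + g) h = inner f h + inner g h"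
    by (simp add: inner_ell2_def cinner_ell2_add_left)
  show "inner (r *\<^sub>R f) g = r * inner f g"
    by (simp add: inner_ell2_def cinner_ell2_scaleR_left)
  show "0 \<le> inner f f"
    by (simp add: inner_ell2_def cinner_ell2_self infsum_nonneg)
  show "norm f = sqrt (inner f f)"
    by (simp add: inner_ell2_def cinner_ell2_self norm_ell2_def)
  show "inner f f = 0 \<longleftrightarrow> f = 0"
  proof
    assume "inner f f = 0"
    then have "(\<Sum>\<^sub>\<infinity>x. (cmod (ell2_coeff f x))\<^sup>2) \<le> 0"
      by (simp add: inner_ell2_def cinner_ell2_self)
    then have "(cmod (ell2_coeff f x))\<^sup>2 = 0" for x
      using nonneg_infsum_le_0D[of "\<lambda>x. (cmod (ell2_coeff f x))\<^sup>2" UNIV x]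
        square_summable_coeff[of f]
      by (simp add: square_summable_def)
    then show "f = 0"
      by (intro ell2_coeff_inject[THEN iffD1]) (auto simp: zero_ell2.rep_eq)
  next
    assume "f = 0"
    then show "inner f f = 0"
      by (simp add: inner_ell2_def cinner_ell2_def zero_ell2.rep_eq)
  qed
qed

end


section \<open>Involutive normed algebras, embeddings and direct limits\<close>

text \<open>The algebraic part of the signature of a C*-algebra comes from the module records of
  HOL-Algebra; the ring of scalars is always the field of complex numbers.\<close>

record 'a cstar = "(complex, 'a) module" +
  adj :: "'a \<Rightarrow> 'a"
  nrm :: "'a \<Rightarrow> real"

text \<open>The embeddings of C*-algebras are the injective *-homomorphisms; these are automatically
  isometric. They are not required to preserve units.\<close>

definition star_homomorphism ::
    "('a, 'c) cstar_scheme \<Rightarrow> ('b, 'd) cstar_scheme \<Rightarrow> ('a \<Rightarrow> 'b) \<Rightarrow> bool" where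
  "star_homomorphism A B \<Phi> \<longleftrightarrow>
     \<Phi> \<in> carrier A \<rightarrow> carrier B \<and>
     (\<forall>a\<in>carrier A. \<forall>b\<in>carrier A. \<Phi> (a \<oplus>\<^bsub>A\<^esub> b) = \<Phi> a \<oplus>\<^bsub>B\<^esub> \<Phi> b) \<and>
     (\<forall>c. \<forall>a\<in>carrier A. \<Phi> (c \<odot>\<^bsub>A\<^esub> a) = c \<odot>\<^bsub>B\<^esub> \<Phi> a) \<and>
     (\<forall>a\<in>carrier A. \<forall>b\<in>carrier A. \<Phi> (a \<otimes>\<^bsub>A\<^esub> b) = \<Phi> a \<otimes>\<^bsub>B\<^esub> \<Phi> b) \<and>
     (\<forall>a\<in>carrier A. \<Phi> (adj A a) = adj B (\<Phi> a))"

definition cstar_embedding ::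
    "('a, 'c) cstar_scheme \<Rightarrow> ('b, 'd) cstar_scheme \<Rightarrow> ('a \<Rightarrow> 'b) \<Rightarrow> bool" where
  "cstar_embedding A B \<Phi> \<longleftrightarrow> star_homomorphism A B \<Phi> \<and> inj_on \<Phi> (carrier A)"

text \<open>The direct limit of $A_0 \to A_1 \to A_2 \to \cdots$ with connecting maps
  $\varphi_n : A_n \to A_{n+1}$ is constructed in the usual way as a subalgebra of the quotient
  $\prod_n A_n / \bigoplus_n A_n$ of the bounded sequences by the null sequences: it is the
  closure of the set of classes of those sequences with $a_{n+1} = \varphi_n(a_n)$ for all large
  $n$. The quotient norm of the class of $a$ is $\limsup_n \|a_n\|$, whence the description of
  the closure in \<open>limit_seqs\<close>; the sequences in this set are automatically bounded if all
  $\varphi_n$ are contractive.\<close>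

definition coherent_seqs :: "(nat \<Rightarrow> 'a cstar) \<Rightarrow> (nat \<Rightarrow> 'a \<Rightarrow> 'a) \<Rightarrow> (nat \<Rightarrow> 'a) set" where
  "coherent_seqs A \<phi> = {a. (\<forall>n. a n \<in> carrier (A n)) \<and>
     (\<forall>\<^sub>F n in sequentially. a (Suc n) = \<phi> n (a n))}"

definition limit_seqs :: "(nat \<Rightarrow> 'a cstar) \<Rightarrow> (nat \<Rightarrow> 'a \<Rightarrow> 'a) \<Rightarrow> (nat \<Rightarrow> 'a) set" where
  "limit_seqs A \<phi> = {a. (\<forall>n. a n \<in> carrier (A n)) \<and>
     (\<forall>\<epsilon>>0. \<exists>b\<in>coherent_seqs A \<phi>.
        \<forall>\<^sub>F n in sequentially. nrm (A n) (a n \<ominus>\<^bsub>A n\<^esub> b n) < \<epsilon>)}"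

definition limit_class ::
    "(nat \<Rightarrow> 'a cstar) \<Rightarrow> (nat \<Rightarrow> 'a \<Rightarrow> 'a) \<Rightarrow> (nat \<Rightarrow> 'a) \<Rightarrow> (nat \<Rightarrow> 'a) set" where
  "limit_class A \<phi> a = {b \<in> limit_seqs A \<phi>.
     (\<lambda>n. nrm (A n) (b n \<ominus>\<^bsub>A n\<^esub> a n)) \<longlonglongrightarrow> 0}"

text \<open>As for the quotient rings in HOL-Algebra, the operations on classes are written as unions
  over all representatives.\<close>

definition direct_limit ::
    "(nat \<Rightarrow> 'a cstar) \<Rightarrow> (nat \<Rightarrow> 'a \<Rightarrow> 'a) \<Rightarrow> (nat \<Rightarrow> 'a) set cstar" where
  "direct_limit A \<phi> = \<lparr>
     carrier = limit_class A \<phi> ` limit_seqs A \<phi>,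
     mult = (\<lambda>P Q. \<Union>a\<in>P. \<Union>b\<in>Q. limit_class A \<phi> (\<lambda>n. a n \<otimes>\<^bsub>A n\<^esub> b n)),
     one = limit_class A \<phi> (\<lambda>n. \<one>\<^bsub>A n\<^esub>),
     zero = limit_class A \<phi> (\<lambda>n. \<zero>\<^bsub>A n\<^esub>),
     add = (\<lambda>P Q. \<Union>a\<in>P. \<Union>b\<in>Q. limit_class A \<phi> (\<lambda>n. a n \<oplus>\<^bsub>A n\<^esub> b n)),
     smult = (\<lambda>c P. \<Union>a\<in>P. limit_class A \<phi> (\<lambda>n. c \<odot>\<^bsub>A n\<^esub> a n)),
     adj = (\<lambda>P. \<Union>a\<in>P. limit_class A \<phi> (\<lambda>n. adj (A n) (a n))),
     nrm = (\<lambda>P. THE r. \<forall>a\<in>P. (\<lambda>n. nrm (A n) (a n)) \<longlonglongrightarrow> r)\<rparr>"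


section \<open>The CAR-algebra\<close>

definition vec_norm2 :: "complex Matrix.vec \<Rightarrow> real" where
  "vec_norm2 v = sqrt (\<Sum>i<dim_vec v. (cmod (vec_index v i))\<^sup>2)"

definition mat_opnorm :: "complex mat \<Rightarrow> real" where
  "mat_opnorm M = (SUP v\<in>{v \<in> carrier_vec (dim_col M). vec_norm2 v \<le> 1}. vec_norm2 (M *\<^sub>v v))"

definition matrix_cstar :: "nat \<Rightarrow> complex mat cstar" where
  "matrix_cstar k = \<lparr>
     carrier = carrier_mat k k,
     mult = (*),
     one = 1\<^sub>m k,
     zero = 0\<^sub>m k k,
     add = (+),
     smult = (\<cdot>\<^sub>m),
     adj = mat_adjoint,
     nrm = mat_opnorm\<rparr>"

text \<open>The connecting map $M_k \to M_{2k}$ sends $M$ to $\mathrm{diag}(M, M)$. Any other unital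
  *-homomorphism $M_{2^n} \to M_{2^{n+1}}$ is unitarily equivalent to this one, so that the choice
  does not affect the isomorphism class of the direct limit.\<close>

definition block_double :: "complex mat \<Rightarrow> complex mat" where
  "block_double M = four_block_mat M (0\<^sub>m (dim_row M) (dim_col M)) (0\<^sub>m (dim_row M) (dim_col M)) M"

definition CAR_algebra :: "(nat \<Rightarrow> complex mat) set cstar" where
  "CAR_algebra = direct_limit (\<lambda>n. matrix_cstar (2 ^ n)) (\<lambda>n. block_double)"


section \<open>Bounded operators on $\ell^2(X)$ and the uniform Roe algebra\<close>

type_synonym 'a ell2_op = "'a ell2 \<Rightarrow>\<^sub>L 'a ell2"

text \<open>Elements of the library type of bounded linear maps are only real linear; the complex
  linear ones form a norm closed subset.\<close>

definition complex_linear_ops :: "'a ell2_op set" where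
  "complex_linear_ops = {a. \<forall>c f. blinfun_apply a (scaleC_ell2 c f) = scaleC_ell2 c (blinfun_apply a f)}"

definition op_adjoint :: "'a ell2_op \<Rightarrow> 'a ell2_op" where
  "op_adjoint a = (THE b. b \<in> complex_linear_ops \<and>
     (\<forall>f g. cinner_ell2 (blinfun_apply a f) g = cinner_ell2 f (blinfun_apply b g)))"

definition bounded_ops :: "'a itself \<Rightarrow> 'a ell2_op cstar" where
  "bounded_ops _ = \<lparr>
     carrier = complex_linear_ops,
     mult = (o\<^sub>L),
     one = id_blinfun,
     zero = 0,
     add = (+),
     smult = (\<lambda>c a. Blinfun (\<lambda>f. scaleC_ell2 c (blinfun_apply a f))),
     adj = op_adjoint,
     nrm = norm\<rparr>"

definition mat_coeff :: "'a ell2_op \<Rightarrow> 'a \<Rightarrow> 'a \<Rightarrow> complex" where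
  "mat_coeff a x y = cinner_ell2 (blinfun_apply a (delta_ell2 y)) (delta_ell2 x)"

definition propagation :: "'a::metric_space ell2_op \<Rightarrow> ennreal" where
  "propagation a = Sup {ennreal (dist x y) | x y. mat_coeff a x y \<noteq> 0}"

text \<open>On a uniformly locally finite space, every matrix of finite propagation with uniformly
  bounded entries defines a bounded operator, so that starting from bounded operators loses
  nothing.\<close>

definition algebraic_uniform_roe :: "'a::metric_space ell2_op set" where
  "algebraic_uniform_roe = {a \<in> complex_linear_ops.
     propagation a < \<infinity> \<and> (\<exists>C. \<forall>x y. cmod (mat_coeff a x y) \<le> C)}"

definition uniform_roe_algebra :: "'a::metric_space itself \<Rightarrow> 'a ell2_op cstar" where
  "uniform_roe_algebra X = bounded_ops X \<lparr>carrier := closure algebraic_uniform_roe\<rparr>"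

text \<open>Since \<open>card\<close> is 0 on infinite sets, finiteness of the balls is stated separately.\<close>

definition uniformly_locally_finite :: "'a::metric_space itself \<Rightarrow> bool" where
  "uniformly_locally_finite _ \<longleftrightarrow>
     (\<forall>r>0. \<exists>N. \<forall>x::'a. finite (ball x r) \<and> card (ball x r) \<le> N)"

end

theory Submission
  imports Defs
begin

text \<open>Number the points of every block of $\Pi_n$ by $0, \dots, 2^n - 1$ and let a matrix in
  $M_{2^n}(\mathbb{C})$ act on all blocks simultaneously, via \<open>block_op\<close>. As all blocks have the size of
  the matrix, this is an isometric *-representation $\pi_n$ of $M_{2^n}(\mathbb{C})$ on $\ell^2(X)$
  (\<open>norm_block_op\<close>, \<open>block_op_adjoint\<close>, \<open>block_op_mult\<close>), and as the diameters of the blocks are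
  bounded, its values have finite propagation.

  Since $\Pi_n$ refines $\Pi_{n+1}$ and the sizes double, every block of $\Pi_{n+1}$ is the union of
  exactly two blocks of $\Pi_n$. The numberings can therefore be chosen recursively: the points of
  one of the two halves keep their number and those of the other have $2^n$ added to it. With this
  choice $\mathrm{diag}(M, M)$ acts on the blocks of $\Pi_{n+1}$ as $M$ does on those of $\Pi_n$, that is
  $\pi_{n+1} \circ \varphi_n = \pi_n$ for the connecting maps $\varphi_n$ of the CAR-algebra
  (\<open>block_op_block_double_addr\<close>).

  A compatible family of isometric representations extends to the direct limit
  (\<open>direct_limit_embedding\<close>): a sequence $(a_n)$ belongs to the algebra of which the direct limit is
  the quotient precisely when the operators $\pi_n(a_n)$ converge in norm, and two sequences
  represent the same class precisely when these limits agree. Mapping the class of $(a_n)$ to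
  $\lim_n \pi_n(a_n)$ is thus a well-defined injective *-homomorphism, and its values lie in the norm
  closure of the operators of finite propagation.\<close>

section \<open>Completeness of $\ell^2(X)$\<close>

lemma norm_ell2_square: "(norm f)\<^sup>2 = (\<Sum>\<^sub>\<infinity>x. (cmod (ell2_coeff f x))\<^sup>2)"
  by (simp add: norm_ell2_def infsum_nonneg)

lemma sum_coeff_le_norm_square:
  assumes "finite F"
  shows "(\<Sum>x\<in>F. (cmod (ell2_coeff f x))\<^sup>2) \<le> (norm f)\<^sup>2"
  unfolding norm_ell2_square
  by (rule finite_sum_le_infsum) (use assms square_summable_coeff[of f] in \<open>auto simp: square_summable_def\<close>)

lemma square_summableI:
  assumes "\<And>F. finite F \<Longrightarrow> (\<Sum>x\<in>F. (cmod (f x))\<^sup>2) \<le> C"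
  shows "square_summable f"
  unfolding square_summable_def
proof (rule nonneg_bdd_above_summable_on)
  show "bdd_above (sum (\<lambda>x. (cmod (f x))\<^sup>2) ` {F. F \<subseteq> UNIV \<and> finite F})"
    by (rule bdd_aboveI2[where M = C]) (simp add: assms)
qed simp

lemma norm_ell2_leI:
  assumes "0 \<le> C" "\<And>F. finite F \<Longrightarrow> (\<Sum>x\<in>F. (cmod (ell2_coeff f x))\<^sup>2) \<le> C\<^sup>2"
  shows "norm f \<le> C"
proof -
  have "(norm f)\<^sup>2 \<le> C\<^sup>2"
    unfolding norm_ell2_square
    by (rule infsum_le_finite_sums) (use assms square_summable_coeff[of f] in \<open>auto simp: square_summable_def\<close>)
  then show ?thesis
    using assms(1) by (rule power2_le_imp_le)
qed

lemma cmod_coeff_le_norm: "cmod (ell2_coeff f x) \<le> norm f"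
  by (rule power2_le_imp_le) (use sum_coeff_le_norm_square[of "{x}" f] in simp_all)

text \<open>Completeness enters only through the Banach space of bounded operators on $\ell^2(X)$: the
  operators representing the elements of the direct limit are obtained as limits of Cauchy
  sequences.\<close>

instance ell2 :: (type) banach
proof
  fix X :: "nat \<Rightarrow> 'a ell2"
  assume X: "Cauchy X"
  have "Cauchy (\<lambda>n. ell2_coeff (X n) x)" for x
  proof (rule metric_CauchyI)
    fix e :: real assume "0 < e"
    then obtain M where M: "\<And>m n. M \<le> m \<Longrightarrow> M \<le> n \<Longrightarrow> dist (X m) (X n) < e"
      using metric_CauchyD[OF X] by blast
    have "dist (ell2_coeff (X m) x) (ell2_coeff (X n) x) < e" if "M \<le> m" "M \<le> n" for m n
      using cmod_coeff_le_norm[of "X m - X n" x] M[OF that]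
      by (simp add: dist_norm minus_ell2.rep_eq)
    then show "\<exists>M. \<forall>m\<ge>M. \<forall>n\<ge>M. dist (ell2_coeff (X m) x) (ell2_coeff (X n) x) < e" by blast
  qed
  then have "\<forall>x. \<exists>l. (\<lambda>n. ell2_coeff (X n) x) \<longlonglongrightarrow> l"
    by (simp add: Cauchy_convergent_iff convergent_def)
  then obtain g where g: "\<And>x. (\<lambda>n. ell2_coeff (X n) x) \<longlonglongrightarrow> g x" by metis
  \<comment> \<open>Letting \<open>m\<close> tend to infinity in a finite partial sum of $\|X_n - X_m\|^2$.\<close>
  have tail: "(\<Sum>x\<in>F. (cmod (ell2_coeff (X n) x - g x))\<^sup>2) \<le> e\<^sup>2"
    if M: "\<And>m n. M \<le> m \<Longrightarrow> M \<le> n \<Longrightarrow> dist (X m) (X n) < e" and "finite F" "M \<le> n" for M e F n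
  proof (rule Lim_bounded[where M = M])
    show "(\<lambda>m. \<Sum>x\<in>F. (cmod (ell2_coeff (X n) x - ell2_coeff (X m) x))\<^sup>2)
        \<longlonglongrightarrow> (\<Sum>x\<in>F. (cmod (ell2_coeff (X n) x - g x))\<^sup>2)"
      by (intro tendsto_sum tendsto_power tendsto_norm tendsto_diff tendsto_const g)
    show "\<forall>m\<ge>M. (\<Sum>x\<in>F. (cmod (ell2_coeff (X n) x - ell2_coeff (X m) x))\<^sup>2) \<le> e\<^sup>2"
    proof (intro allI impI)
      fix m assume "M \<le> m"
      have "(\<Sum>x\<in>F. (cmod (ell2_coeff (X n) x - ell2_coeff (X m) x))\<^sup>2) \<le> (norm (X n - X m))\<^sup>2"
        using sum_coeff_le_norm_square[OF \<open>finite F\<close>, of "X n - X m"] by (simp add: minus_ell2.rep_eq)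
      also have "\<dots> \<le> e\<^sup>2"
        using M[OF \<open>M \<le> n\<close> \<open>M \<le> m\<close>] by (intro power_mono) (auto simp: dist_norm)
      finally show "(\<Sum>x\<in>F. (cmod (ell2_coeff (X n) x - ell2_coeff (X m) x))\<^sup>2) \<le> e\<^sup>2" .
    qed
  qed
  obtain M where M: "\<And>m n. M \<le> m \<Longrightarrow> M \<le> n \<Longrightarrow> dist (X m) (X n) < 1"
    using metric_CauchyD[OF X, of 1] by auto
  have "square_summable (\<lambda>x. ell2_coeff (X M) x - g x)"
  proof (rule square_summableI)
    show "(\<Sum>x\<in>F. (cmod (ell2_coeff (X M) x - g x))\<^sup>2) \<le> 1\<^sup>2" if "finite F" for F
      by (rule tail[OF M that order_refl])
  qed
  then have "square_summable (\<lambda>x. ell2_coeff (X M) x + - 1 * (ell2_coeff (X M) x - g x))"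
    by (intro square_summable_add square_summable_scale square_summable_coeff)
  then have gs: "square_summable g" by simp
  have "X \<longlonglongrightarrow> Abs_ell2 g"
  proof (rule metric_LIMSEQ_I)
    fix e :: real assume "0 < e"
    then obtain K where K: "\<And>m n. K \<le> m \<Longrightarrow> K \<le> n \<Longrightarrow> dist (X m) (X n) < e / 2"
      using metric_CauchyD[OF X, of "e / 2"] by (meson half_gt_zero)
    have "dist (X n) (Abs_ell2 g) < e" if "K \<le> n" for n
    proof -
      have "norm (X n - Abs_ell2 g) \<le> e / 2"
      proof (rule norm_ell2_leI)
        show "(\<Sum>x\<in>F. (cmod (ell2_coeff (X n - Abs_ell2 g) x))\<^sup>2) \<le> (e / 2)\<^sup>2" if "finite F" for F
          using tail[OF K that \<open>K \<le> n\<close>] gs by (simp add: minus_ell2.rep_eq Abs_ell2_inverse)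
      qed (use \<open>0 < e\<close> in simp)
      then show ?thesis using \<open>0 < e\<close> by (simp add: dist_norm)
    qed
    then show "\<exists>K. \<forall>n\<ge>K. dist (X n) (Abs_ell2 g) < e" by blast
  qed
  then show "convergent X" by (rule convergentI)
qed


section \<open>Complex linear operators and adjoints\<close>

lemma norm_scaleC_ell2: "norm (scaleC_ell2 c f) = cmod c * norm f"
proof -
  have "(norm (scaleC_ell2 c f))\<^sup>2 = (cmod c)\<^sup>2 * (norm f)\<^sup>2"
    unfolding norm_ell2_square scaleC_ell2.rep_eq norm_mult power_mult_distrib
    by (rule infsum_cmult_right')
  then show ?thesis
    by (intro power2_eq_imp_eq[of "norm (scaleC_ell2 c f)" "cmod c * norm f"])
      (auto simp: power_mult_distrib)
qed

lemma bounded_linear_scaleC_ell2: "bounded_linear (scaleC_ell2 c)"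
proof (rule bounded_linear_intro)
  show "scaleC_ell2 c (f + g) = scaleC_ell2 c f + scaleC_ell2 c g" for f g :: "'a ell2"
    by transfer (simp add: algebra_simps)
  show "scaleC_ell2 c (r *\<^sub>R f) = r *\<^sub>R scaleC_ell2 c f" for r and f :: "'a ell2"
    by transfer (simp add: algebra_simps)
  show "norm (scaleC_ell2 c f) \<le> norm f * cmod c" for f :: "'a ell2"
    by (simp add: norm_scaleC_ell2)
qed

definition scaleC_op :: "complex \<Rightarrow> 'a ell2_op" where
  "scaleC_op c = Blinfun (scaleC_ell2 c)"

lemma scaleC_op_apply [simp]: "blinfun_apply (scaleC_op c) f = scaleC_ell2 c f"
  by (simp add: scaleC_op_def bounded_linear_Blinfun_apply bounded_linear_scaleC_ell2)

lemma smult_bounded_ops: "c \<odot>\<^bsub>bounded_ops X\<^esub> a = scaleC_op c o\<^sub>L a"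
proof -
  have "(\<lambda>f. scaleC_ell2 c (blinfun_apply a f)) = blinfun_apply (scaleC_op c o\<^sub>L a)"
    by (simp add: fun_eq_iff)
  then show ?thesis
    by (simp add: bounded_ops_def blinfun_apply_inverse)
qed

lemma closed_complex_linear_ops: "closed (complex_linear_ops :: 'a ell2_op set)"
proof -
  have eq: "complex_linear_ops =
      (\<Inter>c. \<Inter>f. {a :: 'a ell2_op. blinfun_apply a (scaleC_ell2 c f) = scaleC_ell2 c (blinfun_apply a f)})"
    by (auto simp: complex_linear_ops_def)
  have cl: "closed {a :: 'a ell2_op. blinfun_apply a (scaleC_ell2 c f) = scaleC_ell2 c (blinfun_apply a f)}"
    for c f
    by (intro closed_Collect_eq continuous_intros bounded_linear.continuous_on[OF bounded_linear_scaleC_ell2])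
  show ?thesis unfolding eq by (intro closed_INT ballI cl)
qed

text \<open>The complex inner product is determined by the real one, because its imaginary part at
  \<open>g\<close> is the real part at \<open>\<i> g\<close>. Adjoints can thus be handled with the real inner product,
  whose continuity passes adjoint pairs to limits.\<close>

lemma cinner_ell2_eq_inner:
  "cinner_ell2 f g = Complex (inner f g) (inner f (scaleC_ell2 \<i> g))"
proof -
  have "cinner_ell2 f (scaleC_ell2 \<i> g) = - \<i> * cinner_ell2 f g"
    unfolding cinner_ell2_def scaleC_ell2.rep_eq
    by (subst infsum_cmult_right'[symmetric]) (simp add: mult_ac)
  then show ?thesis
    by (simp add: inner_ell2_def complex_eq_iff)
qed

text \<open>Since \<open>b\<close> is complex linear, comparing real parts at \<open>g\<close> and at \<open>\<i> g\<close> recovers the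
  complex identity that defines the adjoint. Since the adjoint is unique, the
  description in \<open>op_adjoint\<close> then denotes \<open>b\<close>.\<close>

lemma op_adjoint_eqI:
  assumes b: "b \<in> complex_linear_ops"
    and adj: "\<And>f g. inner (blinfun_apply a f) g = inner f (blinfun_apply b g)"
  shows "op_adjoint a = b"
  unfolding op_adjoint_def
proof (rule the_equality, intro conjI allI)
  show "b \<in> complex_linear_ops" by (rule b)
  show "cinner_ell2 (blinfun_apply a f) g = cinner_ell2 f (blinfun_apply b g)" for f g
    using b by (simp add: cinner_ell2_eq_inner adj complex_linear_ops_def)
next
  fix b' :: "'a ell2_op"
  assume b': "b' \<in> complex_linear_ops \<and>
    (\<forall>f g. cinner_ell2 (blinfun_apply a f) g = cinner_ell2 f (blinfun_apply b' g))"
  then have adj': "inner f (blinfun_apply b' g) = inner f (blinfun_apply b g)" for f g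
  proof -
    have "inner f (blinfun_apply b' g) = inner (blinfun_apply a f) g"
      using b' by (simp add: inner_ell2_def)
    then show ?thesis by (simp only: adj)
  qed
  have "inner (blinfun_apply b' g - blinfun_apply b g) (blinfun_apply b' g - blinfun_apply b g) = 0" for g
    using adj'[of "blinfun_apply b' g - blinfun_apply b g" g] by (simp add: inner_diff_right)
  then show "b' = b" by (auto intro: blinfun_eqI)
qed

text \<open>This is $\|bg\|^2 = \langle abg, g\rangle \le \|a\| \|bg\| \|g\|$. It makes taking adjoints
  preserve Cauchy sequences.\<close>

lemma norm_adjoint_le:
  fixes a b :: "'a ell2_op"
  assumes adj: "\<And>f g. inner (blinfun_apply a f) g = inner f (blinfun_apply b g)"
  shows "norm b \<le> norm a"
proof (rule norm_blinfun_bound)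
  fix g
  have "(norm (blinfun_apply b g))\<^sup>2 = inner (blinfun_apply a (blinfun_apply b g)) g"
    by (simp add: adj power2_norm_eq_inner)
  also have "\<dots> \<le> norm (blinfun_apply a (blinfun_apply b g)) * norm g"
    by (rule norm_cauchy_schwarz)
  also have "\<dots> \<le> (norm a * norm (blinfun_apply b g)) * norm g"
    by (intro mult_right_mono norm_blinfun norm_ge_zero)
  finally have "norm (blinfun_apply b g) * norm (blinfun_apply b g)
      \<le> norm (blinfun_apply b g) * (norm a * norm g)"
    by (simp add: power2_eq_square mult_ac)
  then show "norm (blinfun_apply b g) \<le> norm a * norm g"
    by (cases "norm (blinfun_apply b g) = 0") (simp, metis mult_left_le_imp_le norm_ge_zero order_le_less)
qed simp


section \<open>Isometric representations of a direct system\<close>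

text \<open>A compatible family of isometric *-representations $\pi_n$ of a direct system on $\ell^2(X)$.
  The adjoint is specified through the inner product rather than through \<open>op_adjoint\<close>, so
  that the condition survives limits; \<open>op_adjoint_eqI\<close> translates back.\<close>

locale direct_system_representation =
  fixes A :: "nat \<Rightarrow> 'b cstar"
    and \<phi> :: "nat \<Rightarrow> 'b \<Rightarrow> 'b"
    and \<pi> :: "nat \<Rightarrow> 'b \<Rightarrow> 'x ell2_op"
  assumes abelian_group: "abelian_group (A n)"
    and mult_closed: "\<lbrakk>a \<in> carrier (A n); b \<in> carrier (A n)\<rbrakk> \<Longrightarrow> a \<otimes>\<^bsub>A n\<^esub> b \<in> carrier (A n)"
    and smult_closed: "a \<in> carrier (A n) \<Longrightarrow> c \<odot>\<^bsub>A n\<^esub> a \<in> carrier (A n)"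
    and adj_closed: "a \<in> carrier (A n) \<Longrightarrow> adj (A n) a \<in> carrier (A n)"
    and map_closed: "a \<in> carrier (A n) \<Longrightarrow> \<phi> n a \<in> carrier (A (Suc n))"
    and rep_linear: "a \<in> carrier (A n) \<Longrightarrow> \<pi> n a \<in> complex_linear_ops"
    and rep_add: "\<lbrakk>a \<in> carrier (A n); b \<in> carrier (A n)\<rbrakk> \<Longrightarrow> \<pi> n (a \<oplus>\<^bsub>A n\<^esub> b) = \<pi> n a + \<pi> n b"
    and rep_mult: "\<lbrakk>a \<in> carrier (A n); b \<in> carrier (A n)\<rbrakk> \<Longrightarrow> \<pi> n (a \<otimes>\<^bsub>A n\<^esub> b) = \<pi> n a o\<^sub>L \<pi> n b"
    and rep_smult: "a \<in> carrier (A n) \<Longrightarrow> \<pi> n (c \<odot>\<^bsub>A n\<^esub> a) = scaleC_op c o\<^sub>L \<pi> n a"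
    and rep_adj: "a \<in> carrier (A n) \<Longrightarrow>
      inner (blinfun_apply (\<pi> n a) f) g = inner f (blinfun_apply (\<pi> n (adj (A n) a)) g)"
    and rep_norm: "a \<in> carrier (A n) \<Longrightarrow> norm (\<pi> n a) = nrm (A n) a"
    and rep_map: "a \<in> carrier (A n) \<Longrightarrow> \<pi> (Suc n) (\<phi> n a) = \<pi> n a"
begin

lemma add_closed: "\<lbrakk>a \<in> carrier (A n); b \<in> carrier (A n)\<rbrakk> \<Longrightarrow> a \<oplus>\<^bsub>A n\<^esub> b \<in> carrier (A n)"
  by (rule abelian_monoid.a_closed[OF abelian_group.axioms(1)[OF abelian_group]])

lemma rep_minus:
  assumes "a \<in> carrier (A n)" "b \<in> carrier (A n)"
  shows "\<pi> n (a \<ominus>\<^bsub>A n\<^esub> b) = \<pi> n a - \<pi> n b"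
proof -
  interpret abelian_group "A n" by (rule abelian_group)
  have "a \<ominus>\<^bsub>A n\<^esub> b \<oplus>\<^bsub>A n\<^esub> b = a"
    using assms by (simp add: minus_eq a_assoc l_neg)
  then have "\<pi> n (a \<ominus>\<^bsub>A n\<^esub> b) + \<pi> n b = \<pi> n a"
    using assms rep_add[of "a \<ominus>\<^bsub>A n\<^esub> b" n b] by simp
  then show ?thesis by (simp add: algebra_simps)
qed

lemma nrm_minus:
  assumes "a \<in> carrier (A n)" "b \<in> carrier (A n)"
  shows "nrm (A n) (a \<ominus>\<^bsub>A n\<^esub> b) = dist (\<pi> n a) (\<pi> n b)"
proof -
  interpret abelian_group "A n" by (rule abelian_group)
  show ?thesis
    using assms rep_norm[of "a \<ominus>\<^bsub>A n\<^esub> b" n] by (simp add: rep_minus dist_norm)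
qed

text \<open>The image in $A_{k+m}$ of an element of $A_k$.\<close>

fun transport :: "nat \<Rightarrow> 'b \<Rightarrow> nat \<Rightarrow> 'b" where
  "transport k a 0 = a"
| "transport k a (Suc m) = \<phi> (k + m) (transport k a m)"

lemma transport:
  assumes "a \<in> carrier (A k)"
  shows "transport k a m \<in> carrier (A (k + m)) \<and> \<pi> (k + m) (transport k a m) = \<pi> k a"
  by (induction m) (use assms in \<open>auto simp: map_closed rep_map\<close>)

lemma coherent_seqs_rep_eventually_const:
  assumes "b \<in> coherent_seqs A \<phi>"
  obtains k where "\<And>n. k \<le> n \<Longrightarrow> \<pi> n (b n) = \<pi> k (b k)"
proof -
  have carr: "b n \<in> carrier (A n)" for n
    using assms by (simp add: coherent_seqs_def)
  obtain k where k: "\<And>n. k \<le> n \<Longrightarrow> b (Suc n) = \<phi> n (b n)"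
    using assms by (auto simp: coherent_seqs_def eventually_sequentially)
  have "\<pi> n (b n) = \<pi> k (b k)" if "k \<le> n" for n
    using that by (induction n rule: dec_induct) (auto simp: k rep_map carr)
  then show thesis by (rule that)
qed

text \<open>A coherent sequence is represented by an eventually constant sequence of operators. As the
  representations are isometric, being approximable by coherent sequences means that the
  operators $\pi_n(a_n)$ form a Cauchy sequence: conversely, a Cauchy sequence is approximated by
  the coherent sequences that continue one of its terms $a_k$ by the connecting maps. All closure
  properties of \<open>limit_seqs\<close> follow from this description.\<close>

lemma limit_seqs_iff:
  "a \<in> limit_seqs A \<phi> \<longleftrightarrow> (\<forall>n. a n \<in> carrier (A n)) \<and> convergent (\<lambda>n. \<pi> n (a n))"
proof (intro iffI conjI)
  assume a: "a \<in> limit_seqs A \<phi>"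
  then show carr: "\<forall>n. a n \<in> carrier (A n)" by (simp add: limit_seqs_def)
  have "Cauchy (\<lambda>n. \<pi> n (a n))"
    unfolding Cauchy_altdef2
  proof (intro allI impI)
    fix e :: real assume "0 < e"
    then obtain b where b: "b \<in> coherent_seqs A \<phi>"
      and ab: "\<forall>\<^sub>F n in sequentially. nrm (A n) (a n \<ominus>\<^bsub>A n\<^esub> b n) < e / 2"
      using a half_gt_zero[OF \<open>0 < e\<close>] unfolding limit_seqs_def by blast
    have carr_b: "b n \<in> carrier (A n)" for n
      using b by (simp add: coherent_seqs_def)
    obtain k where k: "\<And>n. k \<le> n \<Longrightarrow> \<pi> n (b n) = \<pi> k (b k)"
      using coherent_seqs_rep_eventually_const[OF b] by blast
    obtain m where m: "\<And>n. m \<le> n \<Longrightarrow> dist (\<pi> n (a n)) (\<pi> n (b n)) < e / 2"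
      using ab carr carr_b by (auto simp: eventually_sequentially nrm_minus)
    have "dist (\<pi> n (a n)) (\<pi> (max k m) (a (max k m))) < e" if "max k m \<le> n" for n
    proof (rule dist_triangle_half_l)
      show "dist (\<pi> n (a n)) (\<pi> k (b k)) < e / 2"
        using m[of n] k[of n] that by simp
      show "dist (\<pi> (max k m) (a (max k m))) (\<pi> k (b k)) < e / 2"
        using m[of "max k m"] k[of "max k m"] by simp
    qed
    then show "\<exists>M. \<forall>n\<ge>M. dist (\<pi> n (a n)) (\<pi> M (a M)) < e" by blast
  qed
  then show "convergent (\<lambda>n. \<pi> n (a n))" by (simp add: Cauchy_convergent_iff)
next
  assume a: "(\<forall>n. a n \<in> carrier (A n)) \<and> convergent (\<lambda>n. \<pi> n (a n))"
  then have carr: "a n \<in> carrier (A n)" for n by blast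
  have "\<exists>b\<in>coherent_seqs A \<phi>. \<forall>\<^sub>F n in sequentially. nrm (A n) (a n \<ominus>\<^bsub>A n\<^esub> b n) < e" if "0 < e" for e
  proof -
    from a have "Cauchy (\<lambda>n. \<pi> n (a n))" by (simp add: Cauchy_convergent_iff)
    then obtain k where k: "\<And>n. k \<le> n \<Longrightarrow> dist (\<pi> n (a n)) (\<pi> k (a k)) < e"
      using \<open>0 < e\<close> unfolding Cauchy_altdef2 by blast
    \<comment> \<open>Below \<open>k\<close> the values of a coherent sequence are arbitrary elements of the carriers.\<close>
    define b where "b n = (if k \<le> n then transport k (a k) (n - k) else a n)" for n
    have b: "b n \<in> carrier (A n)" "k \<le> n \<Longrightarrow> \<pi> n (b n) = \<pi> k (a k)" for n
      using transport[OF carr, of k "n - k"] carr by (auto simp: b_def)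
    have "b (Suc n) = \<phi> n (b n)" if "k \<le> n" for n
      using that by (simp add: b_def Suc_diff_le)
    then have "b \<in> coherent_seqs A \<phi>"
      using b(1) by (auto simp: coherent_seqs_def eventually_sequentially)
    moreover have "nrm (A n) (a n \<ominus>\<^bsub>A n\<^esub> b n) < e" if "k \<le> n" for n
      using k[OF that] b that carr by (simp add: nrm_minus)
    ultimately show ?thesis
      by (auto simp: eventually_sequentially)
  qed
  then show "a \<in> limit_seqs A \<phi>"
    using carr by (simp add: limit_seqs_def)
qed

definition seq_op :: "(nat \<Rightarrow> 'b) \<Rightarrow> 'x ell2_op" where
  "seq_op a = lim (\<lambda>n. \<pi> n (a n))"

lemma limit_seqs_carrier: "a \<in> limit_seqs A \<phi> \<Longrightarrow> a n \<in> carrier (A n)"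
  by (simp add: limit_seqs_iff)

lemma seq_op_LIMSEQ: "a \<in> limit_seqs A \<phi> \<Longrightarrow> (\<lambda>n. \<pi> n (a n)) \<longlonglongrightarrow> seq_op a"
  by (simp add: limit_seqs_iff seq_op_def convergent_LIMSEQ_iff)

lemma limit_seqsI:
  assumes "\<And>n. a n \<in> carrier (A n)" "(\<lambda>n. \<pi> n (a n)) \<longlonglongrightarrow> L"
  shows "a \<in> limit_seqs A \<phi>" "seq_op a = L"
  using assms by (auto simp: limit_seqs_iff seq_op_def convergent_def limI)

text \<open>The null sequences are those whose operators tend to zero, so a class consists of all
  sequences with a given limit operator.\<close>

lemma limit_class_eq:
  assumes "a \<in> limit_seqs A \<phi>"
  shows "limit_class A \<phi> a = {b \<in> limit_seqs A \<phi>. seq_op b = seq_op a}"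
proof -
  have "(\<lambda>n. nrm (A n) (b n \<ominus>\<^bsub>A n\<^esub> a n)) \<longlonglongrightarrow> 0 \<longleftrightarrow> seq_op b = seq_op a"
    if b: "b \<in> limit_seqs A \<phi>" for b
  proof -
    have "(\<lambda>n. nrm (A n) (b n \<ominus>\<^bsub>A n\<^esub> a n)) = (\<lambda>n. dist (\<pi> n (b n)) (\<pi> n (a n)))"
      using assms b by (simp add: nrm_minus limit_seqs_carrier)
    moreover have lim: "(\<lambda>n. dist (\<pi> n (b n)) (\<pi> n (a n))) \<longlonglongrightarrow> dist (seq_op b) (seq_op a)"
      by (intro tendsto_dist seq_op_LIMSEQ assms b)
    ultimately show ?thesis
      using LIMSEQ_unique[OF lim, of 0] lim by auto
  qed
  then show ?thesis by (auto simp: limit_class_def)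
qed

lemma limit_class_self: "a \<in> limit_seqs A \<phi> \<Longrightarrow> a \<in> limit_class A \<phi> a"
  by (simp add: limit_class_eq)

lemma seq_op_add:
  assumes "a \<in> limit_seqs A \<phi>" "b \<in> limit_seqs A \<phi>"
  shows "(\<lambda>n. a n \<oplus>\<^bsub>A n\<^esub> b n) \<in> limit_seqs A \<phi>"
    and "seq_op (\<lambda>n. a n \<oplus>\<^bsub>A n\<^esub> b n) = seq_op a + seq_op b"
proof -
  have "(\<lambda>n. \<pi> n (a n \<oplus>\<^bsub>A n\<^esub> b n)) \<longlonglongrightarrow> seq_op a + seq_op b"
    using tendsto_add[OF assms[THEN seq_op_LIMSEQ]] assms by (simp add: rep_add limit_seqs_carrier)
  from limit_seqsI[OF _ this] assms
  show "(\<lambda>n. a n \<oplus>\<^bsub>A n\<^esub> b n) \<in> limit_seqs A \<phi>" "seq_op (\<lambda>n. a n \<oplus>\<^bsub>A n\<^esub> b n) = seq_op a + seq_op b"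
    by (simp_all add: add_closed limit_seqs_carrier)
qed

lemma seq_op_mult:
  assumes "a \<in> limit_seqs A \<phi>" "b \<in> limit_seqs A \<phi>"
  shows "(\<lambda>n. a n \<otimes>\<^bsub>A n\<^esub> b n) \<in> limit_seqs A \<phi>"
    and "seq_op (\<lambda>n. a n \<otimes>\<^bsub>A n\<^esub> b n) = seq_op a o\<^sub>L seq_op b"
proof -
  have "(\<lambda>n. \<pi> n (a n \<otimes>\<^bsub>A n\<^esub> b n)) \<longlonglongrightarrow> (seq_op a o\<^sub>L seq_op b)"
    using bounded_bilinear.tendsto[OF bounded_bilinear_blinfun_compose assms[THEN seq_op_LIMSEQ]] assms
    by (simp add: rep_mult limit_seqs_carrier)
  from limit_seqsI[OF _ this] assms
  show "(\<lambda>n. a n \<otimes>\<^bsub>A n\<^esub> b n) \<in> limit_seqs A \<phi>" "seq_op (\<lambda>n. a n \<otimes>\<^bsub>A n\<^esub> b n) = seq_op a o\<^sub>L seq_op b"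
    by (simp_all add: mult_closed limit_seqs_carrier)
qed

lemma seq_op_smult:
  assumes "a \<in> limit_seqs A \<phi>"
  shows "(\<lambda>n. c \<odot>\<^bsub>A n\<^esub> a n) \<in> limit_seqs A \<phi>"
    and "seq_op (\<lambda>n. c \<odot>\<^bsub>A n\<^esub> a n) = scaleC_op c o\<^sub>L seq_op a"
proof -
  have "(\<lambda>n. \<pi> n (c \<odot>\<^bsub>A n\<^esub> a n)) \<longlonglongrightarrow> (scaleC_op c o\<^sub>L seq_op a)"
    using bounded_bilinear.tendsto[OF bounded_bilinear_blinfun_compose tendsto_const seq_op_LIMSEQ[OF assms]] assms
    by (simp add: rep_smult limit_seqs_carrier)
  from limit_seqsI[OF _ this] assms
  show "(\<lambda>n. c \<odot>\<^bsub>A n\<^esub> a n) \<in> limit_seqs A \<phi>" "seq_op (\<lambda>n. c \<odot>\<^bsub>A n\<^esub> a n) = scaleC_op c o\<^sub>L seq_op a"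
    by (simp_all add: smult_closed limit_seqs_carrier)
qed

lemma seq_op_linear:
  assumes "a \<in> limit_seqs A \<phi>"
  shows "seq_op a \<in> complex_linear_ops"
  by (rule closed_sequentially[OF closed_complex_linear_ops _ seq_op_LIMSEQ[OF assms]])
    (use assms in \<open>simp add: rep_linear limit_seqs_carrier\<close>)

lemma seq_op_adj:
  assumes "a \<in> limit_seqs A \<phi>"
  shows "(\<lambda>n. adj (A n) (a n)) \<in> limit_seqs A \<phi>"
    and "seq_op (\<lambda>n. adj (A n) (a n)) = op_adjoint (seq_op a)"
proof -
  note carr = limit_seqs_carrier[OF assms]
  have "Cauchy (\<lambda>n. \<pi> n (a n))"
    using assms by (simp add: limit_seqs_iff Cauchy_convergent_iff)
  \<comment> \<open>The adjoint of a difference is at most as large as the difference.\<close>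
  moreover have "dist (\<pi> m (adj (A m) (a m))) (\<pi> n (adj (A n) (a n))) \<le> dist (\<pi> m (a m)) (\<pi> n (a n))" for m n
    unfolding dist_norm
    by (rule norm_adjoint_le)
      (simp add: blinfun.diff_left inner_diff_left inner_diff_right rep_adj[OF carr])
  ultimately have "Cauchy (\<lambda>n. \<pi> n (adj (A n) (a n)))"
    unfolding Cauchy_def by (meson le_less_trans)
  then show lim: "(\<lambda>n. adj (A n) (a n)) \<in> limit_seqs A \<phi>"
    using carr by (simp add: limit_seqs_iff Cauchy_convergent_iff adj_closed)
  have "inner (blinfun_apply (seq_op a) f) g = inner f (blinfun_apply (seq_op (\<lambda>n. adj (A n) (a n))) g)" for f g
  proof (rule LIMSEQ_unique)
    show "(\<lambda>n. inner (blinfun_apply (\<pi> n (a n)) f) g) \<longlonglongrightarrow> inner (blinfun_apply (seq_op a) f) g"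
      by (intro tendsto_inner blinfun.tendsto seq_op_LIMSEQ[OF assms] tendsto_const)
    show "(\<lambda>n. inner (blinfun_apply (\<pi> n (a n)) f) g)
        \<longlonglongrightarrow> inner f (blinfun_apply (seq_op (\<lambda>n. adj (A n) (a n))) g)"
      unfolding rep_adj[OF carr]
      by (intro tendsto_inner blinfun.tendsto seq_op_LIMSEQ[OF lim] tendsto_const)
  qed
  then show "seq_op (\<lambda>n. adj (A n) (a n)) = op_adjoint (seq_op a)"
    by (intro op_adjoint_eqI[symmetric] seq_op_linear lim)
qed

text \<open>The choice of representative is harmless by \<open>limit_class_eq\<close>. Defining the map on arbitrary
  sets of sequences fits the operations of \<open>direct_limit\<close>, which are unions over representatives:
  to evaluate it on such a union one only has to know that the union is nonempty and that all its
  members have the same limit operator.\<close>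

definition class_op :: "(nat \<Rightarrow> 'b) set \<Rightarrow> 'x ell2_op" where
  "class_op U = seq_op (SOME a. a \<in> U)"

lemma class_op_eqI:
  assumes "U \<noteq> {}" "\<And>a. a \<in> U \<Longrightarrow> seq_op a = L"
  shows "class_op U = L"
  unfolding class_op_def using assms by (metis ex_in_conv someI)

lemma class_op_limit_class: "a \<in> limit_seqs A \<phi> \<Longrightarrow> class_op (limit_class A \<phi> a) = seq_op a"
  by (rule class_op_eqI) (use limit_class_self in \<open>auto simp: limit_class_eq\<close>)

text \<open>Passing from a class to its limit operator turns the termwise operations into those of
  operators, and it is injective because a class is determined by its limit operator.\<close>

theorem direct_limit_embedding:
  assumes "closed S" "\<And>n a. a \<in> carrier (A n) \<Longrightarrow> \<pi> n a \<in> S"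
  shows "cstar_embedding (direct_limit A \<phi>) (bounded_ops TYPE('x) \<lparr>carrier := S\<rparr>) class_op"
proof -
  let ?L = "limit_seqs A \<phi>" and ?B = "bounded_ops TYPE('x) \<lparr>carrier := S\<rparr>"
  have S: "seq_op a \<in> S" if "a \<in> ?L" for a
    by (rule closed_sequentially[OF assms(1) _ seq_op_LIMSEQ[OF that]])
      (use that in \<open>simp add: assms(2) limit_seqs_carrier\<close>)
  have add: "class_op (limit_class A \<phi> a \<oplus>\<^bsub>direct_limit A \<phi>\<^esub> limit_class A \<phi> b) = seq_op a + seq_op b"
    if "a \<in> ?L" "b \<in> ?L" for a b
  proof (rule class_op_eqI)
    show "limit_class A \<phi> a \<oplus>\<^bsub>direct_limit A \<phi>\<^esub> limit_class A \<phi> b \<noteq> {}"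
      using limit_class_self[OF that(1)] limit_class_self[OF that(2)] limit_class_self[OF seq_op_add(1)[OF that]]
      by (simp add: direct_limit_def) blast
  next
    fix c assume "c \<in> limit_class A \<phi> a \<oplus>\<^bsub>direct_limit A \<phi>\<^esub> limit_class A \<phi> b"
    then obtain a' b' where a': "a' \<in> limit_class A \<phi> a" and b': "b' \<in> limit_class A \<phi> b"
      and c: "c \<in> limit_class A \<phi> (\<lambda>n. a' n \<oplus>\<^bsub>A n\<^esub> b' n)"
      by (auto simp: direct_limit_def)
    show "seq_op c = seq_op a + seq_op b"
      using limit_class_eq[OF that(1)] limit_class_eq[OF that(2)] a' b' c
      by (simp add: limit_class_eq seq_op_add)
  qed
  have mult: "class_op (limit_class A \<phi> a \<otimes>\<^bsub>direct_limit A \<phi>\<^esub> limit_class A \<phi> b) = seq_op a o\<^sub>L seq_op b"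
    if "a \<in> ?L" "b \<in> ?L" for a b
  proof (rule class_op_eqI)
    show "limit_class A \<phi> a \<otimes>\<^bsub>direct_limit A \<phi>\<^esub> limit_class A \<phi> b \<noteq> {}"
      using limit_class_self[OF that(1)] limit_class_self[OF that(2)] limit_class_self[OF seq_op_mult(1)[OF that]]
      by (simp add: direct_limit_def) blast
  next
    fix c assume "c \<in> limit_class A \<phi> a \<otimes>\<^bsub>direct_limit A \<phi>\<^esub> limit_class A \<phi> b"
    then obtain a' b' where a': "a' \<in> limit_class A \<phi> a" and b': "b' \<in> limit_class A \<phi> b"
      and c: "c \<in> limit_class A \<phi> (\<lambda>n. a' n \<otimes>\<^bsub>A n\<^esub> b' n)"
      by (auto simp: direct_limit_def)
    show "seq_op c = seq_op a o\<^sub>L seq_op b"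
      using limit_class_eq[OF that(1)] limit_class_eq[OF that(2)] a' b' c
      by (simp add: limit_class_eq seq_op_mult)
  qed
  have smult: "class_op (c \<odot>\<^bsub>direct_limit A \<phi>\<^esub> limit_class A \<phi> a) = scaleC_op c o\<^sub>L seq_op a"
    if "a \<in> ?L" for c a
  proof (rule class_op_eqI)
    show "c \<odot>\<^bsub>direct_limit A \<phi>\<^esub> limit_class A \<phi> a \<noteq> {}"
      using limit_class_self[OF that] limit_class_self[OF seq_op_smult(1)[OF that]]
      by (simp add: direct_limit_def) blast
  next
    fix d assume "d \<in> c \<odot>\<^bsub>direct_limit A \<phi>\<^esub> limit_class A \<phi> a"
    then obtain a' where a': "a' \<in> limit_class A \<phi> a" and d: "d \<in> limit_class A \<phi> (\<lambda>n. c \<odot>\<^bsub>A n\<^esub> a' n)"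
      by (auto simp: direct_limit_def)
    show "seq_op d = scaleC_op c o\<^sub>L seq_op a"
      using limit_class_eq[OF that] a' d by (simp add: limit_class_eq seq_op_smult)
  qed
  have adj: "class_op (adj (direct_limit A \<phi>) (limit_class A \<phi> a)) = op_adjoint (seq_op a)"
    if "a \<in> ?L" for a
  proof (rule class_op_eqI)
    show "adj (direct_limit A \<phi>) (limit_class A \<phi> a) \<noteq> {}"
      using limit_class_self[OF that] limit_class_self[OF seq_op_adj(1)[OF that]]
      by (simp add: direct_limit_def) blast
  next
    fix d assume "d \<in> adj (direct_limit A \<phi>) (limit_class A \<phi> a)"
    then obtain a' where a': "a' \<in> limit_class A \<phi> a" and d: "d \<in> limit_class A \<phi> (\<lambda>n. adj (A n) (a' n))"
      by (auto simp: direct_limit_def)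
    show "seq_op d = op_adjoint (seq_op a)"
      using limit_class_eq[OF that] a' d by (simp add: limit_class_eq seq_op_adj)
  qed
  have carrier: "carrier (direct_limit A \<phi>) = limit_class A \<phi> ` ?L"
    by (simp add: direct_limit_def)
  have ops: "carrier ?B = S" "\<And>x y. x \<oplus>\<^bsub>?B\<^esub> y = x + y" "\<And>x y. x \<otimes>\<^bsub>?B\<^esub> y = x o\<^sub>L y"
    "\<And>c x. c \<odot>\<^bsub>?B\<^esub> x = scaleC_op c o\<^sub>L x" "\<And>x. adj ?B x = op_adjoint x"
    using smult_bounded_ops by (simp_all add: bounded_ops_def)
  have inj: "inj_on class_op (limit_class A \<phi> ` ?L)"
  proof (rule inj_onI)
    fix U V assume "U \<in> limit_class A \<phi> ` ?L" "V \<in> limit_class A \<phi> ` ?L" "class_op U = class_op V"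
    then obtain a b where "a \<in> ?L" "b \<in> ?L" "U = limit_class A \<phi> a" "V = limit_class A \<phi> b"
      and "seq_op a = seq_op b"
      by (auto simp: class_op_limit_class)
    then show "U = V" by (simp add: limit_class_eq)
  qed
  show ?thesis
    unfolding cstar_embedding_def star_homomorphism_def carrier ops
    using inj by (auto simp: class_op_limit_class S add mult smult adj)
qed

end


section \<open>The operator norm of a matrix\<close>

lemma vec_norm2_square: "(vec_norm2 v)\<^sup>2 = (\<Sum>i<dim_vec v. (cmod (vec_index v i))\<^sup>2)"
  by (simp add: vec_norm2_def sum_nonneg)

lemma vec_norm2_nonneg [simp]: "0 \<le> vec_norm2 v"
  by (simp add: vec_norm2_def sum_nonneg)

lemma vec_norm2_smult: "vec_norm2 (c \<cdot>\<^sub>v v) = cmod c * vec_norm2 v"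
proof (rule power2_eq_imp_eq)
  show "(vec_norm2 (c \<cdot>\<^sub>v v))\<^sup>2 = (cmod c * vec_norm2 v)\<^sup>2"
    by (simp add: vec_norm2_square power_mult_distrib norm_mult sum_distrib_left)
qed simp_all

lemma cmod_index_le_vec_norm2:
  assumes "i < dim_vec v"
  shows "cmod (vec_index v i) \<le> vec_norm2 v"
proof (rule power2_le_imp_le)
  show "(cmod (vec_index v i))\<^sup>2 \<le> (vec_norm2 v)\<^sup>2"
    unfolding vec_norm2_square
    by (rule member_le_sum[where f = "\<lambda>i. (cmod (vec_index v i))\<^sup>2"]) (use assms in auto)
qed simp

lemma index_mult_mat_vec_sum:
  assumes "M \<in> carrier_mat n m" "v \<in> carrier_vec m" "i < n"
  shows "vec_index (M *\<^sub>v v) i = (\<Sum>j<m. M $$ (i, j) * vec_index v j)"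
  using assms by (auto simp: scalar_prod_def lessThan_atLeast0)

text \<open>A crude entrywise bound, which makes the supremum in \<open>mat_opnorm\<close> meaningful: on the unit
  ball every coordinate has modulus at most one.\<close>

lemma mat_opnorm_bdd_above:
  assumes M: "M \<in> carrier_mat n m"
  shows "bdd_above ((\<lambda>v. vec_norm2 (M *\<^sub>v v)) ` {v \<in> carrier_vec m. vec_norm2 v \<le> 1})"
proof (rule bdd_aboveI2)
  fix v assume "v \<in> {v \<in> carrier_vec m. vec_norm2 v \<le> 1}"
  then have v: "v \<in> carrier_vec m" "vec_norm2 v \<le> 1" by auto
  have le: "cmod (vec_index (M *\<^sub>v v) i) \<le> (\<Sum>j<m. cmod (M $$ (i, j)))" if "i < n" for i
  proof -
    have "cmod (vec_index (M *\<^sub>v v) i) \<le> (\<Sum>j<m. cmod (M $$ (i, j) * vec_index v j))"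
      unfolding index_mult_mat_vec_sum[OF M v(1) that] by (rule norm_sum)
    also have "\<dots> \<le> (\<Sum>j<m. cmod (M $$ (i, j)))"
    proof (rule sum_mono)
      fix j assume "j \<in> {..<m}"
      then have "cmod (vec_index v j) \<le> 1"
        using cmod_index_le_vec_norm2[of j v] v by simp
      then show "cmod (M $$ (i, j) * vec_index v j) \<le> cmod (M $$ (i, j))"
        by (simp add: norm_mult mult_left_le)
    qed
    finally show ?thesis .
  qed
  show "vec_norm2 (M *\<^sub>v v) \<le> sqrt (\<Sum>i<n. (\<Sum>j<m. cmod (M $$ (i, j)))\<^sup>2)"
    unfolding vec_norm2_def using M le
    by (intro real_sqrt_le_mono) (auto intro!: sum_mono power_mono simp del: index_mult_mat_vec)
qed

lemma vec_norm2_mult_le_opnorm_unit: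
  assumes "M \<in> carrier_mat n m" "v \<in> carrier_vec m" "vec_norm2 v \<le> 1"
  shows "vec_norm2 (M *\<^sub>v v) \<le> mat_opnorm M"
  unfolding mat_opnorm_def using assms mat_opnorm_bdd_above[OF assms(1)]
  by (intro cSUP_upper) auto

lemma mat_opnorm_nonneg:
  assumes "M \<in> carrier_mat n m"
  shows "0 \<le> mat_opnorm M"
proof -
  have "vec_norm2 (0\<^sub>v m) \<le> 1" by (simp add: vec_norm2_def)
  then show ?thesis
    using vec_norm2_mult_le_opnorm_unit[OF assms, of "0\<^sub>v m"] order_trans[OF vec_norm2_nonneg] by auto
qed

text \<open>Rescaling \<open>v\<close> to norm one; if its norm is zero then both sides vanish.\<close>

lemma vec_norm2_mult_le:
  assumes M: "M \<in> carrier_mat n m" and v: "v \<in> carrier_vec m"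
  shows "vec_norm2 (M *\<^sub>v v) \<le> mat_opnorm M * vec_norm2 v"
proof (cases "vec_norm2 v = 0")
  case True
  then have "cmod (vec_index v j) = 0" if "j < m" for j
    using cmod_index_le_vec_norm2[of j v] v that by simp
  then have "vec_index (M *\<^sub>v v) i = 0" if "i < n" for i
    using index_mult_mat_vec_sum[OF M v that] by simp
  then have "vec_norm2 (M *\<^sub>v v) = 0"
    using M by (simp add: vec_norm2_def del: index_mult_mat_vec)
  then show ?thesis using True by simp
next
  case False
  define c where "c = complex_of_real (1 / vec_norm2 v)"
  have c: "cmod c = 1 / vec_norm2 v"
    unfolding c_def norm_of_real by simp
  have "vec_norm2 (M *\<^sub>v (c \<cdot>\<^sub>v v)) \<le> mat_opnorm M"
    using M v False by (intro vec_norm2_mult_le_opnorm_unit) (auto simp: vec_norm2_smult c)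
  moreover have "M *\<^sub>v (c \<cdot>\<^sub>v v) = c \<cdot>\<^sub>v (M *\<^sub>v v)"
    using M v by (rule mult_mat_vec)
  ultimately have "vec_norm2 (M *\<^sub>v v) / vec_norm2 v \<le> mat_opnorm M"
    by (simp add: vec_norm2_smult c)
  moreover have "0 < vec_norm2 v"
    using False vec_norm2_nonneg[of v] by linarith
  ultimately show ?thesis by (simp add: pos_divide_le_eq)
qed

lemma mat_opnorm_leI:
  assumes "M \<in> carrier_mat n m"
    and "\<And>v. v \<in> carrier_vec m \<Longrightarrow> vec_norm2 v \<le> 1 \<Longrightarrow> vec_norm2 (M *\<^sub>v v) \<le> C"
  shows "mat_opnorm M \<le> C"
  unfolding mat_opnorm_def
proof (rule cSUP_least)
  have "0\<^sub>v m \<in> {v \<in> carrier_vec (dim_col M). vec_norm2 v \<le> 1}"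
    using assms(1) by (simp add: vec_norm2_def)
  then show "{v \<in> carrier_vec (dim_col M). vec_norm2 v \<le> 1} \<noteq> {}" by blast
qed (use assms in auto)

lemma mat_adjoint_carrier:
  "M \<in> carrier_mat n m \<Longrightarrow> mat_adjoint M \<in> carrier_mat m n"
  by (auto simp: mat_adjoint_def mat_of_rows_def)

lemma index_mat_adjoint:
  assumes "M \<in> carrier_mat n m" "i < m" "j < n"
  shows "mat_adjoint M $$ (i, j) = cnj (M $$ (j, i))"
  using assms by (auto simp: mat_adjoint_def mat_of_rows_def)


section \<open>Block diagonal operators with a repeated block\<close>

text \<open>The set \<open>blk x\<close> is the block of \<open>x\<close> and \<open>addr\<close> numbers the points within each block. The same
  matrix \<open>M\<close> acts on the functions on every block, whose points are identified with the indices of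
  \<open>M\<close> by their addresses.\<close>

definition block_coeff :: "('a \<Rightarrow> 'a set) \<Rightarrow> ('a \<Rightarrow> nat) \<Rightarrow> complex mat \<Rightarrow> ('a \<Rightarrow> complex) \<Rightarrow> 'a \<Rightarrow> complex" where
  "block_coeff blk addr M f x = (\<Sum>y\<in>blk x. M $$ (addr x, addr y) * f y)"

definition block_op :: "('a \<Rightarrow> 'a set) \<Rightarrow> ('a \<Rightarrow> nat) \<Rightarrow> complex mat \<Rightarrow> 'a ell2_op" where
  "block_op blk addr M = Blinfun (\<lambda>f. Abs_ell2 (block_coeff blk addr M (ell2_coeff f)))"

lemma ell2_eqI: "(\<And>x. ell2_coeff f x = ell2_coeff g x) \<Longrightarrow> f = g"
  by (rule ell2_coeff_inject[THEN iffD1]) (rule ext)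

lemma cinner_delta: "cinner_ell2 f (delta_ell2 x) = ell2_coeff f x"
proof -
  have "cinner_ell2 f (delta_ell2 x) = (\<Sum>\<^sub>\<infinity>y\<in>{x}. ell2_coeff f y * cnj (ell2_coeff (delta_ell2 x) y))"
    unfolding cinner_ell2_def by (rule infsum_cong_neutral) (auto simp: delta_ell2.rep_eq)
  then show ?thesis by (simp add: delta_ell2.rep_eq)
qed

lemma norm_delta: "norm (delta_ell2 x) = 1"
proof -
  have "cinner_ell2 (delta_ell2 x) (delta_ell2 x) = 1"
    by (simp add: cinner_delta delta_ell2.rep_eq)
  then show ?thesis by (simp add: norm_eq_sqrt_inner inner_ell2_def)
qed

lemma cmod_mat_coeff_le: "cmod (mat_coeff a x y) \<le> norm a"
proof -
  have "cmod (mat_coeff a x y) \<le> norm (blinfun_apply a (delta_ell2 y))"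
    unfolding mat_coeff_def cinner_delta by (rule cmod_coeff_le_norm)
  also have "\<dots> \<le> norm a * norm (delta_ell2 y)" by (rule norm_blinfun)
  finally show ?thesis by (simp add: norm_delta)
qed

locale block_addressing =
  fixes N :: nat and blk :: "'a \<Rightarrow> 'a set" and addr :: "'a \<Rightarrow> nat"
  assumes mem_blk: "x \<in> blk x"
    and blk_eq: "y \<in> blk x \<Longrightarrow> blk y = blk x"
    and addr: "bij_betw addr (blk x) {..<N}"
begin

lemma finite_blk: "finite (blk x)"
  using bij_betw_finite[OF addr[of x]] by simp

lemma addr_less: "addr x < N"
  using bij_betwE[OF addr[of x]] mem_blk by blast

lemma sum_addr: "(\<Sum>y\<in>blk x. h (addr y)) = (\<Sum>i<N. h i)"
  by (rule sum.reindex_bij_betw[OF addr])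

lemma disjoint_blk: "blk x \<noteq> blk y \<Longrightarrow> blk x \<inter> blk y = {}"
  using blk_eq by blast

text \<open>The restriction of \<open>f\<close> to the block of \<open>x\<close>, listed by addresses.\<close>

definition block_vec :: "'a \<Rightarrow> ('a \<Rightarrow> complex) \<Rightarrow> complex Matrix.vec" where
  "block_vec x f = Matrix.vec N (\<lambda>i. f (inv_into (blk x) addr i))"

lemma block_vec_carrier: "block_vec x f \<in> carrier_vec N"
  by (simp add: block_vec_def)

lemma index_block_vec:
  assumes "y \<in> blk x"
  shows "vec_index (block_vec x f) (addr y) = f y"
  using assms addr_less[of y] bij_betw_inv_into_left[OF addr assms] by (simp add: block_vec_def)

lemma vec_norm2_block_vec: "(vec_norm2 (block_vec x f))\<^sup>2 = (\<Sum>y\<in>blk x. (cmod (f y))\<^sup>2)"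
proof -
  have "(vec_norm2 (block_vec x f))\<^sup>2 = (\<Sum>i<N. (cmod (vec_index (block_vec x f) i))\<^sup>2)"
    using block_vec_carrier[of x f] by (simp add: vec_norm2_square)
  also have "\<dots> = (\<Sum>y\<in>blk x. (cmod (f y))\<^sup>2)"
    unfolding sum_addr[symmetric, of _ x] by (simp add: index_block_vec)
  finally show ?thesis .
qed

lemma mult_block_vec:
  assumes M: "M \<in> carrier_mat N N"
  shows "M *\<^sub>v block_vec x f = block_vec x (block_coeff blk addr M f)"
proof (rule eq_vecI)
  show "dim_vec (M *\<^sub>v block_vec x f) = dim_vec (block_vec x (block_coeff blk addr M f))"
    using M by (simp add: block_vec_def)
  fix i assume "i < dim_vec (block_vec x (block_coeff blk addr M f))"
  then have i: "i < N" by (simp add: block_vec_def)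
  then have "i \<in> addr ` blk x"
    using addr[of x] by (simp add: bij_betw_def)
  then obtain y where y: "y \<in> blk x" "addr y = i" by blast
  have "vec_index (M *\<^sub>v block_vec x f) i = (\<Sum>z\<in>blk x. M $$ (i, addr z) * vec_index (block_vec x f) (addr z))"
    unfolding index_mult_mat_vec_sum[OF M block_vec_carrier i] by (rule sum_addr[symmetric])
  also have "\<dots> = block_coeff blk addr M f y"
    unfolding block_coeff_def blk_eq[OF y(1)] y(2) by (simp add: index_block_vec)
  also have "\<dots> = vec_index (block_vec x (block_coeff blk addr M f)) i"
    using index_block_vec[OF y(1)] y(2) by simp
  finally show "vec_index (M *\<^sub>v block_vec x f) i = vec_index (block_vec x (block_coeff blk addr M f)) i" .
qed

lemma sum_block_coeff_le:
  assumes M: "M \<in> carrier_mat N N"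
  shows "(\<Sum>y\<in>blk x. (cmod (block_coeff blk addr M f y))\<^sup>2) \<le> (mat_opnorm M)\<^sup>2 * (\<Sum>y\<in>blk x. (cmod (f y))\<^sup>2)"
  unfolding vec_norm2_block_vec[symmetric] mult_block_vec[OF M, symmetric] power_mult_distrib[symmetric]
  by (intro power_mono vec_norm2_mult_le[OF M] block_vec_carrier vec_norm2_nonneg)

lemma sum_blocks:
  fixes h :: "'a \<Rightarrow> real"
  assumes "finite F"
  shows "(\<Sum>y\<in>(\<Union>x\<in>F. blk x). h y) = (\<Sum>B\<in>blk ` F. \<Sum>y\<in>B. h y)"
  using sum.Union_disjoint[of "blk ` F" h] disjoint_blk by (auto simp: finite_blk)

text \<open>Blocks are orthogonal to each other, so the bound on one block sums up to a bound on the
  finite union of all blocks that meet \<open>F\<close>.\<close>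

lemma sum_block_coeff_le_norm:
  assumes M: "M \<in> carrier_mat N N" and F: "finite F"
  shows "(\<Sum>x\<in>F. (cmod (block_coeff blk addr M (ell2_coeff f) x))\<^sup>2) \<le> (mat_opnorm M * norm f)\<^sup>2"
proof -
  let ?U = "\<Union>x\<in>F. blk x"
  have U: "finite ?U" "F \<subseteq> ?U"
    using F finite_blk mem_blk by auto
  have "(\<Sum>x\<in>F. (cmod (block_coeff blk addr M (ell2_coeff f) x))\<^sup>2)
      \<le> (\<Sum>x\<in>?U. (cmod (block_coeff blk addr M (ell2_coeff f) x))\<^sup>2)"
    by (rule sum_mono2) (use U in auto)
  also have "\<dots> = (\<Sum>B\<in>blk ` F. \<Sum>x\<in>B. (cmod (block_coeff blk addr M (ell2_coeff f) x))\<^sup>2)"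
    by (rule sum_blocks[OF F])
  also have "\<dots> \<le> (\<Sum>B\<in>blk ` F. (mat_opnorm M)\<^sup>2 * (\<Sum>x\<in>B. (cmod (ell2_coeff f x))\<^sup>2))"
    by (rule sum_mono) (use sum_block_coeff_le[OF M] in auto)
  also have "\<dots> = (mat_opnorm M)\<^sup>2 * (\<Sum>x\<in>?U. (cmod (ell2_coeff f x))\<^sup>2)"
    by (simp add: sum_blocks[OF F] sum_distrib_left)
  also have "\<dots> \<le> (mat_opnorm M)\<^sup>2 * (norm f)\<^sup>2"
    by (intro mult_left_mono sum_coeff_le_norm_square U) simp
  finally show ?thesis by (simp add: power_mult_distrib)
qed

lemma block_coeff_square_summable:
  assumes "M \<in> carrier_mat N N"
  shows "square_summable (block_coeff blk addr M (ell2_coeff f))"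
  by (rule square_summableI) (rule sum_block_coeff_le_norm[OF assms])

lemma block_op_coeff:
  assumes M: "M \<in> carrier_mat N N"
  shows "ell2_coeff (blinfun_apply (block_op blk addr M) f) = block_coeff blk addr M (ell2_coeff f)"
proof -
  let ?T = "\<lambda>f. Abs_ell2 (block_coeff blk addr M (ell2_coeff f))"
  have T: "ell2_coeff (?T f) = block_coeff blk addr M (ell2_coeff f)" for f
    using block_coeff_square_summable[OF M] by (simp add: Abs_ell2_inverse)
  have "bounded_linear ?T"
  proof (rule bounded_linear_intro)
    show "?T (f + g) = ?T f + ?T g" for f g
      by (rule ell2_eqI, unfold plus_ell2.rep_eq[of "?T f" "?T g"] T)
        (simp add: plus_ell2.rep_eq block_coeff_def algebra_simps sum.distrib)
    show "?T (r *\<^sub>R f) = r *\<^sub>R ?T f" for r f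
      by (rule ell2_eqI, unfold scaleR_ell2.rep_eq[of r "?T f"] T)
        (simp add: scaleR_ell2.rep_eq block_coeff_def sum_distrib_left mult_ac)
    show "norm (?T f) \<le> norm f * mat_opnorm M" for f
    proof (rule norm_ell2_leI)
      show "0 \<le> norm f * mat_opnorm M" using mat_opnorm_nonneg[OF M] by simp
      show "(\<Sum>x\<in>F. (cmod (ell2_coeff (?T f) x))\<^sup>2) \<le> (norm f * mat_opnorm M)\<^sup>2" if "finite F" for F
        unfolding T using sum_block_coeff_le_norm[OF M that] by (simp add: mult.commute)
    qed
  qed
  then show ?thesis
    by (simp add: block_op_def bounded_linear_Blinfun_apply T)
qed

lemma block_op_linear:
  assumes "M \<in> carrier_mat N N"
  shows "block_op blk addr M \<in> complex_linear_ops"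
  unfolding complex_linear_ops_def
  by (auto intro!: ell2_eqI
      simp: block_op_coeff[OF assms] scaleC_ell2.rep_eq block_coeff_def sum_distrib_left mult_ac)

lemma block_op_add:
  assumes "M \<in> carrier_mat N N" "M' \<in> carrier_mat N N"
  shows "block_op blk addr (M + M') = block_op blk addr M + block_op blk addr M'"
  using assms addr_less
  by (intro blinfun_eqI ell2_eqI)
    (auto simp: block_op_coeff blinfun.add_left plus_ell2.rep_eq block_coeff_def algebra_simps sum.distrib)

lemma block_op_smult:
  assumes "M \<in> carrier_mat N N"
  shows "block_op blk addr (c \<cdot>\<^sub>m M) = scaleC_op c o\<^sub>L block_op blk addr M"
  using assms addr_less
  by (intro blinfun_eqI ell2_eqI)
    (auto simp: block_op_coeff scaleC_ell2.rep_eq block_coeff_def sum_distrib_left mult_ac)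

lemma block_op_mult:
  assumes M: "M \<in> carrier_mat N N" and M': "M' \<in> carrier_mat N N"
  shows "block_op blk addr (M * M') = block_op blk addr M o\<^sub>L block_op blk addr M'"
proof (intro blinfun_eqI ell2_eqI)
  fix f and x
  have "block_coeff blk addr M (block_coeff blk addr M' (ell2_coeff f)) x
      = (\<Sum>y\<in>blk x. \<Sum>z\<in>blk x. M $$ (addr x, addr y) * M' $$ (addr y, addr z) * ell2_coeff f z)"
    unfolding block_coeff_def by (intro sum.cong refl) (auto simp: blk_eq sum_distrib_left mult_ac)
  also have "\<dots> = (\<Sum>z\<in>blk x. (\<Sum>y\<in>blk x. M $$ (addr x, addr y) * M' $$ (addr y, addr z)) * ell2_coeff f z)"
    by (subst sum.swap) (simp add: sum_distrib_right)
  also have "\<dots> = block_coeff blk addr (M * M') (ell2_coeff f) x"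
    unfolding block_coeff_def
  proof (intro sum.cong refl arg_cong2[where f = "(*)"])
    fix z
    have "(\<Sum>y\<in>blk x. M $$ (addr x, addr y) * M' $$ (addr y, addr z)) = (\<Sum>k<N. M $$ (addr x, k) * M' $$ (k, addr z))"
      by (rule sum_addr)
    also have "\<dots> = (M * M') $$ (addr x, addr z)"
      using M M' addr_less by (simp add: scalar_prod_def lessThan_atLeast0)
    finally show "(\<Sum>y\<in>blk x. M $$ (addr x, addr y) * M' $$ (addr y, addr z)) = (M * M') $$ (addr x, addr z)" .
  qed
  finally show "ell2_coeff (blinfun_apply (block_op blk addr (M * M')) f) x
      = ell2_coeff (blinfun_apply (block_op blk addr M o\<^sub>L block_op blk addr M') f) x"
    using M M' by (simp add: block_op_coeff)
qed

text \<open>Grouping an absolutely convergent sum by blocks reduces inner product identities to finite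
  sums over a single block.\<close>

lemma infsum_blocks:
  fixes h :: "'a \<Rightarrow> complex"
  assumes "h summable_on UNIV"
  shows "infsum h UNIV = (\<Sum>\<^sub>\<infinity>B\<in>range blk. \<Sum>x\<in>B. h x)"
proof -
  have bij: "bij_betw snd (Sigma (range blk) (\<lambda>B. B)) UNIV"
    unfolding bij_betw_def
  proof
    show "inj_on snd (Sigma (range blk) (\<lambda>B. B))"
      by (rule inj_onI, clarsimp) (metis blk_eq)
    show "snd ` Sigma (range blk) (\<lambda>B. B) = UNIV"
      using mem_blk by (force simp: image_iff)
  qed
  have "infsum h UNIV = infsum (\<lambda>p. h (snd p)) (Sigma (range blk) (\<lambda>B. B))"
    by (rule infsum_reindex_bij_betw[OF bij, symmetric])
  also have "\<dots> = (\<Sum>\<^sub>\<infinity>B\<in>range blk. \<Sum>\<^sub>\<infinity>x\<in>B. h x)"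
    using infsum_Sigma_banach[of "\<lambda>p. h (snd p)" "range blk" "\<lambda>B. B"]
      summable_on_reindex_bij_betw[OF bij, of h] assms
    by simp
  also have "\<dots> = (\<Sum>\<^sub>\<infinity>B\<in>range blk. \<Sum>x\<in>B. h x)"
    by (rule infsum_cong) (auto simp: finite_blk)
  finally show ?thesis .
qed

lemma cinner_blocks:
  "cinner_ell2 f g = (\<Sum>\<^sub>\<infinity>B\<in>range blk. \<Sum>x\<in>B. ell2_coeff f x * cnj (ell2_coeff g x))"
  unfolding cinner_ell2_def by (rule infsum_blocks[OF cinner_ell2_summable])

lemma block_op_adjoint:
  assumes M: "M \<in> carrier_mat N N"
  shows "inner (blinfun_apply (block_op blk addr M) f) g
    = inner f (blinfun_apply (block_op blk addr (mat_adjoint M)) g)"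
proof -
  note M' = mat_adjoint_carrier[OF M]
  have "cinner_ell2 (blinfun_apply (block_op blk addr M) f) g
      = (\<Sum>\<^sub>\<infinity>B\<in>range blk. \<Sum>x\<in>B. block_coeff blk addr M (ell2_coeff f) x * cnj (ell2_coeff g x))"
    by (simp only: cinner_blocks block_op_coeff[OF M])
  also have "\<dots> = (\<Sum>\<^sub>\<infinity>B\<in>range blk. \<Sum>x\<in>B. ell2_coeff f x * cnj (block_coeff blk addr (mat_adjoint M) (ell2_coeff g) x))"
  proof (rule infsum_cong)
    fix B assume "B \<in> range blk"
    then obtain u where B: "B = blk u" by blast
    have "(\<Sum>x\<in>B. block_coeff blk addr M (ell2_coeff f) x * cnj (ell2_coeff g x))
        = (\<Sum>x\<in>B. \<Sum>y\<in>B. M $$ (addr x, addr y) * ell2_coeff f y * cnj (ell2_coeff g x))"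
      unfolding block_coeff_def by (intro sum.cong refl) (auto simp: B blk_eq sum_distrib_right)
    also have "\<dots> = (\<Sum>y\<in>B. \<Sum>x\<in>B. M $$ (addr x, addr y) * ell2_coeff f y * cnj (ell2_coeff g x))"
      by (rule sum.swap)
    also have "\<dots> = (\<Sum>y\<in>B. ell2_coeff f y * cnj (block_coeff blk addr (mat_adjoint M) (ell2_coeff g) y))"
      unfolding block_coeff_def
      by (intro sum.cong refl)
        (auto simp: B blk_eq sum_distrib_left index_mat_adjoint[OF M] addr_less mult_ac)
    finally show "(\<Sum>x\<in>B. block_coeff blk addr M (ell2_coeff f) x * cnj (ell2_coeff g x))
        = (\<Sum>x\<in>B. ell2_coeff f x * cnj (block_coeff blk addr (mat_adjoint M) (ell2_coeff g) x))" .
  qed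
  also have "\<dots> = cinner_ell2 f (blinfun_apply (block_op blk addr (mat_adjoint M)) g)"
    by (simp only: cinner_blocks block_op_coeff[OF M'])
  finally show ?thesis by (simp add: inner_ell2_def)
qed

text \<open>Vectors supported in a single block already attain the operator norm of the matrix.\<close>

lemma norm_block_op:
  assumes M: "M \<in> carrier_mat N N"
  shows "norm (block_op blk addr M) = mat_opnorm M"
proof (rule antisym)
  show "norm (block_op blk addr M) \<le> mat_opnorm M"
  proof (rule norm_blinfun_bound)
    show "0 \<le> mat_opnorm M" by (rule mat_opnorm_nonneg[OF M])
    show "norm (blinfun_apply (block_op blk addr M) f) \<le> mat_opnorm M * norm f" for f
      by (rule norm_ell2_leI)
        (use mat_opnorm_nonneg[OF M] sum_block_coeff_le_norm[OF M] in \<open>auto simp: block_op_coeff[OF M]\<close>)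
  qed
  show "mat_opnorm M \<le> norm (block_op blk addr M)"
  proof (rule mat_opnorm_leI[OF M])
    fix v :: "complex Matrix.vec"
    assume v: "v \<in> carrier_vec N" "vec_norm2 v \<le> 1"
    \<comment> \<open>Any point \<open>u\<close> will do: spread \<open>v\<close> over its block.\<close>
    fix u :: 'a
    define h where "h y = (if y \<in> blk u then vec_index v (addr y) else 0)" for y
    have v_eq: "block_vec u h = v"
    proof (rule eq_vecI)
      fix i assume "i < dim_vec v"
      then have "i \<in> {..<N}" using v by simp
      then show "vec_index (block_vec u h) i = vec_index v i"
        using bij_betw_inv_into_right[OF addr] inv_into_into[of i addr "blk u"] addr[of u]
        by (simp add: block_vec_def h_def bij_betw_def)
    qed (use v block_vec_carrier[of u h] in auto)
    have "(\<Sum>x\<in>F. (cmod (h x))\<^sup>2) \<le> 1\<^sup>2" if "finite F" for F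
    proof -
      have "(\<Sum>x\<in>F. (cmod (h x))\<^sup>2) = (\<Sum>x\<in>F \<inter> blk u. (cmod (h x))\<^sup>2)"
        by (rule sum.mono_neutral_right) (use that in \<open>auto simp: h_def\<close>)
      also have "\<dots> \<le> (\<Sum>x\<in>blk u. (cmod (h x))\<^sup>2)"
        by (rule sum_mono2) (auto simp: finite_blk)
      also have "\<dots> = (vec_norm2 v)\<^sup>2"
        by (simp add: vec_norm2_block_vec[symmetric] v_eq)
      also have "\<dots> \<le> 1\<^sup>2"
        by (rule power_mono) (use v in auto)
      finally show ?thesis .
    qed
    note h = this
    have h_coeff: "ell2_coeff (Abs_ell2 h) = h"
      using square_summableI[OF h] by (simp add: Abs_ell2_inverse)
    have "norm (Abs_ell2 h) \<le> 1"
      by (rule norm_ell2_leI) (use h in \<open>auto simp: h_coeff\<close>)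
    have "(vec_norm2 (M *\<^sub>v v))\<^sup>2 = (\<Sum>y\<in>blk u. (cmod (block_coeff blk addr M h y))\<^sup>2)"
      by (simp add: vec_norm2_block_vec[symmetric] mult_block_vec[OF M, symmetric] v_eq)
    also have "\<dots> \<le> (norm (blinfun_apply (block_op blk addr M) (Abs_ell2 h)))\<^sup>2"
      using sum_coeff_le_norm_square[OF finite_blk[of u], of "blinfun_apply (block_op blk addr M) (Abs_ell2 h)"]
      by (simp add: block_op_coeff[OF M] h_coeff)
    finally have "vec_norm2 (M *\<^sub>v v) \<le> norm (blinfun_apply (block_op blk addr M) (Abs_ell2 h))"
      by (rule power2_le_imp_le) simp
    also have "\<dots> \<le> norm (block_op blk addr M) * norm (Abs_ell2 h)"
      by (rule norm_blinfun)
    also have "\<dots> \<le> norm (block_op blk addr M)"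
      using \<open>norm (Abs_ell2 h) \<le> 1\<close> by (simp add: mult_left_le)
    finally show "vec_norm2 (M *\<^sub>v v) \<le> norm (block_op blk addr M)" .
  qed
qed

lemma mat_coeff_block_op:
  assumes M: "M \<in> carrier_mat N N"
  shows "mat_coeff (block_op blk addr M) x y = (if y \<in> blk x then M $$ (addr x, addr y) else 0)"
proof -
  have "mat_coeff (block_op blk addr M) x y = (\<Sum>z\<in>blk x. if z = y then M $$ (addr x, addr z) else 0)"
    unfolding mat_coeff_def cinner_delta block_op_coeff[OF M] block_coeff_def
    by (intro sum.cong) (auto simp: delta_ell2.rep_eq)
  then show ?thesis by (simp add: finite_blk)
qed

end

text \<open>Matrix coefficients vanish between different blocks, so the propagation is at most the
  supremum of the diameters of the blocks.\<close>

lemma block_op_algebraic_uniform_roe: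
  fixes blk :: "'a::metric_space \<Rightarrow> 'a set"
  assumes "block_addressing N blk addr" and M: "M \<in> carrier_mat N N"
    and D: "\<And>x y. y \<in> blk x \<Longrightarrow> dist x y \<le> D"
  shows "block_op blk addr M \<in> algebraic_uniform_roe"
proof -
  interpret block_addressing N blk addr by fact
  have "propagation (block_op blk addr M) \<le> ennreal D"
    unfolding propagation_def
    by (rule Sup_least) (auto simp: mat_coeff_block_op[OF M] D ennreal_leI split: if_splits)
  also have "\<dots> < \<infinity>" by simp
  finally have "propagation (block_op blk addr M) < \<infinity>" .
  then show ?thesis
    unfolding algebraic_uniform_roe_def
    by (intro CollectI conjI exI allI) (rule block_op_linear[OF M], assumption, rule cmod_mat_coeff_le)
qed

lemma block_double_carrier:
  "M \<in> carrier_mat k k \<Longrightarrow> block_double M \<in> carrier_mat (2 * k) (2 * k)"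
  by (auto simp: block_double_def)

text \<open>If each new block is made of two old blocks, the points of one of which keep their address
  while the points of the other have it raised by \<open>N\<close>, then $\mathrm{diag}(M, M)$ acts on the new
  block by letting \<open>M\<close> act on each of the two old ones.\<close>

lemma block_op_block_double:
  assumes "block_addressing N blk addr" and "block_addressing (2 * N) blk' addr'"
    and M: "M \<in> carrier_mat N N"
    and sub: "\<And>x. blk x \<subseteq> blk' x"
    and addr': "\<And>x. addr' x = addr x \<or> addr' x = addr x + N"
    and half: "\<And>x y. y \<in> blk' x \<Longrightarrow> (addr' x < N \<longleftrightarrow> addr' y < N) \<longleftrightarrow> y \<in> blk x"
  shows "block_op blk' addr' (block_double M) = block_op blk addr M"
proof (intro blinfun_eqI ell2_eqI)
  fix f x
  interpret b: block_addressing N blk addr by fact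
  interpret b': block_addressing "2 * N" blk' addr' by fact
  note D = block_double_carrier[OF M]
  have entry: "block_double M $$ (addr' x, addr' y) = (if y \<in> blk x then M $$ (addr x, addr y) else 0)"
    if "y \<in> blk' x" for y
    using half[OF that] addr'[of x] addr'[of y] b.addr_less[of x] b.addr_less[of y] M
    by (auto simp: block_double_def)
  have "block_coeff blk' addr' (block_double M) (ell2_coeff f) x
      = (\<Sum>y\<in>blk' x. if y \<in> blk x then M $$ (addr x, addr y) * ell2_coeff f y else 0)"
    unfolding block_coeff_def by (intro sum.cong) (auto simp: entry)
  also have "\<dots> = block_coeff blk addr M (ell2_coeff f) x"
    unfolding block_coeff_def
    by (rule sum.mono_neutral_cong_right) (use sub b'.finite_blk in auto)
  finally show "ell2_coeff (blinfun_apply (block_op blk' addr' (block_double M)) f) x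
      = ell2_coeff (blinfun_apply (block_op blk addr M) f) x"
    by (simp add: b.block_op_coeff[OF M] b'.block_op_coeff[OF D])
qed


section \<open>Binary addresses in a nested sequence of blocks\<close>

text \<open>The blocks \<open>blk n x\<close> are the members of the partitions, indexed by the points they contain.
  The level $n = 0$ consists of singletons, to match $M_{2^0}$ as the start of the direct system.\<close>

locale dyadic_blocks =
  fixes blk :: "nat \<Rightarrow> 'a \<Rightarrow> 'a set"
  assumes mem_blk: "x \<in> blk n x"
    and blk_eq: "y \<in> blk n x \<Longrightarrow> blk n y = blk n x"
    and blk_mono: "blk n x \<subseteq> blk (Suc n) x"
    and card_blk: "card (blk n x) = 2 ^ n"
begin

lemma finite_blk: "finite (blk n x)"
  by (rule card_ge_0_finite) (simp add: card_blk)

text \<open>Of the two blocks of level \<open>n\<close> that make up \<open>blk (Suc n) x\<close>, one is selected. It depends only on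
  the block of level \<open>Suc n\<close> and not on \<open>x\<close> (\<open>half_eq\<close>). The \<open>n\<close>-th binary digit of the
  address says whether a point lies outside it.\<close>

definition half :: "nat \<Rightarrow> 'a \<Rightarrow> 'a set" where
  "half n x = blk n (SOME y. y \<in> blk (Suc n) x)"

fun addr :: "nat \<Rightarrow> 'a \<Rightarrow> nat" where
  "addr 0 x = 0"
| "addr (Suc n) x = addr n x + (if x \<in> half n x then 0 else 2 ^ n)"

lemma half_eq: "y \<in> blk (Suc n) x \<Longrightarrow> half n y = half n x"
  by (simp add: half_def blk_eq)

text \<open>Two blocks of size $2^n$ fill a block of size $2^{n+1}$, hence any two of its points outside
  the selected half lie in the same block of level \<open>n\<close>.\<close>

lemma same_half_iff:
  assumes y: "y \<in> blk (Suc n) x"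
  shows "(x \<in> half n x \<longleftrightarrow> y \<in> half n y) \<longleftrightarrow> y \<in> blk n x"
proof -
  define r where "r = (SOME y. y \<in> blk (Suc n) x)"
  have r: "r \<in> blk (Suc n) x"
    unfolding r_def by (rule someI[of "\<lambda>y. y \<in> blk (Suc n) x", OF mem_blk])
  have half: "half n x = blk n r" "half n y = blk n r"
    using half_eq[OF y] by (simp_all add: half_def r_def)
  have mem_iff: "u \<in> blk n v \<longleftrightarrow> blk n u = blk n v" for u v
    using mem_blk[of u n] blk_eq[of u n v] by auto
  have "blk n y = blk n x" if "blk n x \<noteq> blk n r" "blk n y \<noteq> blk n r"
  proof -
    have "blk n r \<inter> blk n x = {}"
      using that(1) by (auto simp: mem_iff)
    then have "card (blk n r \<union> blk n x) = card (blk (Suc n) x)"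
      by (simp add: card_Un_disjoint finite_blk card_blk)
    moreover have "blk n r \<union> blk n x \<subseteq> blk (Suc n) x"
      using blk_mono[of n r] blk_mono[of n x] blk_eq[OF r] by simp
    ultimately have "blk n r \<union> blk n x = blk (Suc n) x"
      by (intro card_subset_eq finite_blk)
    then have "y \<in> blk n r \<union> blk n x" using y by blast
    then have "y \<in> blk n x" using that(2) mem_iff[of y r] by blast
    then show ?thesis by (rule blk_eq)
  qed
  then show ?thesis
    unfolding half mem_iff by metis
qed

lemma addr_less: "addr n x < 2 ^ n"
  by (induction n) auto

lemma addr_lower_half_iff: "addr (Suc n) x < 2 ^ n \<longleftrightarrow> x \<in> half n x"
  using addr_less[of n x] by simp

text \<open>Equal addresses have equal leading digits, so by \<open>same_half_iff\<close> the two points share a block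
  of the previous level, where induction applies.\<close>

lemma inj_on_addr: "inj_on (addr n) (blk n x)"
proof (induction n arbitrary: x)
  case 0
  have "blk 0 x = {x}"
    using card_blk[of 0 x] mem_blk[of x 0] by (auto simp: card_1_singleton_iff)
  then show ?case by simp
next
  case (Suc n)
  show ?case
  proof (rule inj_onI)
    fix y z assume y: "y \<in> blk (Suc n) x" and z: "z \<in> blk (Suc n) x"
      and eq: "addr (Suc n) y = addr (Suc n) z"
    have iff: "y \<in> half n y \<longleftrightarrow> z \<in> half n z"
      using eq addr_lower_half_iff by metis
    then have "z \<in> blk n y"
      using same_half_iff[of z n y] z blk_eq[OF y] by simp
    moreover have "addr n y = addr n z"
      using eq iff by (simp split: if_splits)
    ultimately show "y = z"
      using Suc.IH[of y] mem_blk[of y n] by (simp add: inj_on_def)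
  qed
qed

lemma block_addressing: "block_addressing (2 ^ n) (blk n) (addr n)"
proof
  show "bij_betw (addr n) (blk n x) {..<2 ^ n}" for x
  proof -
    have "addr n ` blk n x = {..<2 ^ n}"
    proof (rule card_subset_eq)
      show "card (addr n ` blk n x) = card {..<2 ^ n :: nat}"
        using inj_on_addr by (simp add: card_image card_blk)
    qed (use addr_less in auto)
    then show ?thesis using inj_on_addr by (simp add: bij_betw_def)
  qed
qed (fact mem_blk blk_eq)+

lemma block_op_block_double_addr:
  assumes "M \<in> carrier_mat (2 ^ n) (2 ^ n)"
  shows "block_op (blk (Suc n)) (addr (Suc n)) (block_double M) = block_op (blk n) (addr n) M"
proof (rule block_op_block_double[OF block_addressing _ assms])
  show "block_addressing (2 * 2 ^ n) (blk (Suc n)) (addr (Suc n))"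
    using block_addressing[of "Suc n"] by simp
  show "(addr (Suc n) x < 2 ^ n \<longleftrightarrow> addr (Suc n) y < 2 ^ n) \<longleftrightarrow> y \<in> blk n x"
    if "y \<in> blk (Suc n) x" for x y
    unfolding addr_lower_half_iff by (rule same_half_iff[OF that])
qed (use blk_mono in auto)

end


section \<open>The CAR-algebra inside the uniform Roe algebra\<close>

lemma abelian_group_matrix_cstar: "abelian_group (matrix_cstar k)"
proof (rule abelian_groupI)
  show "\<exists>y\<in>carrier (matrix_cstar k). y \<oplus>\<^bsub>matrix_cstar k\<^esub> x = \<zero>\<^bsub>matrix_cstar k\<^esub>"
    if "x \<in> carrier (matrix_cstar k)" for x
    using that by (intro bexI[of _ "- x"]) (auto simp: matrix_cstar_def uminus_l_inv_mat)
qed (auto simp: matrix_cstar_def assoc_add_mat intro: comm_add_mat)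

lemma CAR_algebra_embedding:
  fixes blk :: "nat \<Rightarrow> 'a::metric_space \<Rightarrow> 'a set"
  assumes "dyadic_blocks blk"
    and bounded: "\<And>n. \<exists>D. \<forall>x. \<forall>y\<in>blk n x. dist x y \<le> D"
  shows "\<exists>\<Phi>. cstar_embedding CAR_algebra (uniform_roe_algebra TYPE('a)) \<Phi>"
proof -
  interpret dyadic_blocks blk by fact
  let ?A = "\<lambda>n. matrix_cstar (2 ^ n)" and ?\<pi> = "\<lambda>n. block_op (blk n) (addr n)"
  interpret direct_system_representation ?A "\<lambda>n. block_double" ?\<pi>
  proof (rule direct_system_representation.intro)
    fix n a b c f g
    interpret block_addressing "2 ^ n" "blk n" "addr n" by (rule block_addressing)
    show "abelian_group (?A n)" by (rule abelian_group_matrix_cstar)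
    assume "a \<in> carrier (?A n)"
    then have a: "a \<in> carrier_mat (2 ^ n) (2 ^ n)" by (simp add: matrix_cstar_def)
    show "c \<odot>\<^bsub>?A n\<^esub> a \<in> carrier (?A n)" "adj (?A n) a \<in> carrier (?A n)"
      using a mat_adjoint_carrier[OF a] by (simp_all add: matrix_cstar_def)
    show "block_double a \<in> carrier (?A (Suc n))"
      using block_double_carrier[OF a] by (simp add: matrix_cstar_def)
    show "?\<pi> n a \<in> complex_linear_ops" by (rule block_op_linear[OF a])
    show "?\<pi> n (c \<odot>\<^bsub>?A n\<^esub> a) = scaleC_op c o\<^sub>L ?\<pi> n a"
      using block_op_smult[OF a] by (simp add: matrix_cstar_def)
    show "inner (blinfun_apply (?\<pi> n a) f) g = inner f (blinfun_apply (?\<pi> n (adj (?A n) a)) g)"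
      using block_op_adjoint[OF a] by (simp add: matrix_cstar_def)
    show "norm (?\<pi> n a) = nrm (?A n) a"
      using norm_block_op[OF a] by (simp add: matrix_cstar_def)
    show "?\<pi> (Suc n) (block_double a) = ?\<pi> n a"
      by (rule block_op_block_double_addr[OF a])
    assume "b \<in> carrier (?A n)"
    then have b: "b \<in> carrier_mat (2 ^ n) (2 ^ n)" by (simp add: matrix_cstar_def)
    show "a \<otimes>\<^bsub>?A n\<^esub> b \<in> carrier (?A n)"
      using a b by (simp add: matrix_cstar_def)
    show "?\<pi> n (a \<oplus>\<^bsub>?A n\<^esub> b) = ?\<pi> n a + ?\<pi> n b"
      using block_op_add[OF a b] by (simp add: matrix_cstar_def)
    show "?\<pi> n (a \<otimes>\<^bsub>?A n\<^esub> b) = ?\<pi> n a o\<^sub>L ?\<pi> n b"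
      using block_op_mult[OF a b] by (simp add: matrix_cstar_def)
  qed
  have "?\<pi> n a \<in> closure algebraic_uniform_roe" if "a \<in> carrier (?A n)" for n a
  proof -
    obtain D where D: "\<And>x y. y \<in> blk n x \<Longrightarrow> dist x y \<le> D"
      using bounded by blast
    have a: "a \<in> carrier_mat (2 ^ n) (2 ^ n)" using that by (simp add: matrix_cstar_def)
    show ?thesis
      using block_op_algebraic_uniform_roe[OF block_addressing a D] closure_subset by blast
  qed
  then have "cstar_embedding CAR_algebra (uniform_roe_algebra TYPE('a)) class_op"
    unfolding CAR_algebra_def uniform_roe_algebra_def
    by (rule direct_limit_embedding[OF closed_closure])
  then show ?thesis by blast
qed

theorem proposition4p7:
  fixes P :: "nat \<Rightarrow> 'a::metric_space set set"
  assumes "uniformly_locally_finite TYPE('a)"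
    and "\<And>n. n \<ge> 1 \<Longrightarrow> partition_on UNIV (P n)"
    and "\<And>n. n \<ge> 1 \<Longrightarrow> refines UNIV (P n) (P (Suc n))"
    and "\<And>n B. n \<ge> 1 \<Longrightarrow> B \<in> P n \<Longrightarrow> card B = 2 ^ n"
    and "\<And>n. n \<ge> 1 \<Longrightarrow> bdd_above (diameter ` P n)"
  shows "\<exists>\<Phi>. cstar_embedding CAR_algebra (uniform_roe_algebra TYPE('a)) \<Phi>"
proof (rule CAR_algebra_embedding)
  define blk where "blk n x = (if n = 0 then {x} else \<Union>{B \<in> P n. x \<in> B})" for n and x :: 'a
  have blk: "blk n x = B" if "1 \<le> n" "B \<in> P n" "x \<in> B" for n x B
  proof -
    have "{C \<in> P n. x \<in> C} = {B}"
      using assms(2)[OF that(1)] that(2,3) unfolding partition_on_def disjoint_def by blast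
    then show ?thesis using that(1) by (simp add: blk_def)
  qed
  have ex: "\<exists>B\<in>P n. x \<in> B" if "1 \<le> n" for n and x :: 'a
    using assms(2)[OF that] unfolding partition_on_def by blast
  have in_P: "blk n x \<in> P n" "x \<in> blk n x" if "1 \<le> n" for n x
    using ex[OF that, of x] blk[OF that] by auto
  show "dyadic_blocks blk"
  proof
    fix n and x y :: 'a
    show "x \<in> blk n x"
      using in_P(2)[of n x] by (cases "n = 0") (auto simp: blk_def)
    show "blk n y = blk n x" if "y \<in> blk n x"
    proof (cases "n = 0")
      case False
      then show ?thesis using blk[of n "blk n x" y] in_P(1)[of n x] that by simp
    qed (use that in \<open>simp add: blk_def\<close>)
    show "blk n x \<subseteq> blk (Suc n) x"
    proof (cases "n = 0")
      case True
      then show ?thesis using in_P(2)[of "Suc n" x] by (simp add: blk_def)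
    next
      case False
      then obtain C where "C \<in> P (Suc n)" "blk n x \<subseteq> C"
        using assms(3)[of n] in_P(1)[of n x] unfolding refines_def by auto
      then show ?thesis
        using blk[of "Suc n" C x] in_P(2)[of n x] False by auto
    qed
    show "card (blk n x) = 2 ^ n"
      using assms(4)[of n "blk n x"] in_P(1)[of n x] by (cases "n = 0") (auto simp: blk_def)
  qed
  show "\<exists>D. \<forall>x. \<forall>y\<in>blk n x. dist x y \<le> D" for n
  proof (cases "n = 0")
    case True
    then show ?thesis by (auto simp: blk_def)
  next
    case False
    then obtain D where D: "\<And>B. B \<in> P n \<Longrightarrow> diameter B \<le> D"
      using assms(5)[of n] by (auto simp: bdd_above_def)
    have "dist x y \<le> D" if "y \<in> blk n x" for x y
    proof -
      have "finite (blk n x)"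
        using assms(4)[of n "blk n x"] in_P(1)[of n x] False by (intro card_ge_0_finite) simp
      then have "dist x y \<le> diameter (blk n x)"
        using in_P(2)[of n x] that False by (intro diameter_bounded_bound finite_imp_bounded) auto
      also have "\<dots> \<le> D" using D in_P(1)[of n x] False by simp
      finally show ?thesis .
    qed
    then show ?thesis by blast
  qed
qed

end
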